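(* There is a hole in $\mathcal{M}_0$; that is, $\mathbb{D}^*\setminus\mathcal{M}_0$ has a connected component other than the component containing $\{z:0<|z|<1/2\}$.
   Context: For $z\in\mathbb{D}^*=\{0<|z|<1\}$ let $f(x)=zx$, $g(x)=z(x-1)+1$, and let $\Lambda_z$ be the unique nonempty compact subset of $\mathbb{C}$ with $\Lambda_z=f(\Lambda_z)\cup g(\Lambda_z)$. Define $\mathcal{M}_0=\{z\in\mathbb{D}^*:1/2\in\Lambda_z\}$; it is contained in $\{|z|\ge1/2\}$. *)

theory Defs
  imports "HOL-Analysis.Analysis"
begin

definition punctured_disc :: "complex set" where
  "punctured_disc = {z. 0 < cmod z \<and> cmod z < 1}"

definition attractor :: "complex \<Rightarrow> complex set" where
  "attractor z = (THE K. K \<noteq> {} \<and> compact K \<and>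
      K = (\<lambda>x. z * x) ` K \<union> (\<lambda>x. z * (x - 1) + 1) ` K)"

definition M0 :: "complex set" where
  "M0 = {z \<in> punctured_disc. (1/2 :: complex) \<in> attractor z}"

end

theory Submission
  imports Defs
begin

text \<open>
  A point \<open>z\<close> lies in \<open>M0\<close> iff some power series with coefficients \<open>\<plusminus>1\<close> vanishes at \<open>z\<close>. Suppose
  that every such series whose coefficients start with a word \<open>u\<close> has exactly one zero in a disc \<open>D\<close>.
  Then the set \<open>K\<close> of these zeros is connected (an idea of Bousch): for every extension \<open>v\<close> of \<open>u\<close>, of
  length \<open>m\<close>, the series \<open>v / (1 - z\<^sup>m)\<close> and \<open>v / (1 + z\<^sup>m)\<close> first differ at index \<open>m\<close> but have the same
  zero in \<open>D\<close>, so that the two halves into which \<open>K\<close> splits at each further coefficient always meet.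

  Nineteen such connected sets, lying in small discs, form a closed chain in \<open>M0\<close> around the point
  \<open>0.397 + 0.551 i\<close>, which is not in \<open>M0\<close>. Consecutive sets share the zero of the common prefix of
  their words; only the closing of the chain needs an algebraic coincidence. Since the chain winds
  around the point, it separates it from the disc of radius \<open>1 / 2\<close>.
\<close>

section \<open>Power series with coefficients plus or minus one\<close>

text \<open>Membership in \<open>M0\<close> becomes a statement about zeros because the attractor
  consists of the points 1/2 + (1 - z)/2 * (sum of e_k z^k), and 1 - z is nonzero.

  Branching of words alone joins pieces but need not close a loop. The words used here split at
  index 6 into two families, which meet near 0.3968 + 0.5467 i, below the hole, at the zero of their
  common six letters. A closed chain needs a second meeting point above the hole; the algebraic
  coincidence supplies it.

  The zero sets are known to be connected, but no path in them is at hand, so there is no curve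
  whose winding number could be computed. Separation is therefore proved with continuous logarithms
  on two closed connected arcs, a right one and a left one.

  Isolation of a zero is uniform over all tails: the derivative of the word at the centre must beat
  the curvature of the word plus the variation of the tail. With |z| <= 0.692 and derivatives of
  modulus at least 3, words of 15 to 17 letters suffice, and every numerical fact reduces to exact
  integer inequalities.\<close>

definition signs :: "(nat \<Rightarrow> int) set" where
  "signs = {e. \<forall>k. e k = 1 \<or> e k = -1}"

definition series :: "(nat \<Rightarrow> int) \<Rightarrow> complex \<Rightarrow> complex" where
  "series e z = (\<Sum>k. of_int (e k) * z ^ k)"

definition cylinder :: "int list \<Rightarrow> (nat \<Rightarrow> int) set" where
  "cylinder u = {e \<in> signs. map e [0..<length u] = u}"

primrec horner :: "int list \<Rightarrow> complex \<Rightarrow> complex" where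
  "horner [] z = 0"
| "horner (x # xs) z = of_int x + z * horner xs z"

primrec dhorner :: "int list \<Rightarrow> complex \<Rightarrow> complex" where
  "dhorner [] z = 0"
| "dhorner (x # xs) z = horner xs z + z * dhorner xs z"

lemma signs_abs: "e \<in> signs \<Longrightarrow> \<bar>e k\<bar> = 1"
  unfolding signs_def by (metis (mono_tags, lifting) abs_minus_cancel abs_one mem_Collect_eq)

lemma norm_sign: "e \<in> signs \<Longrightarrow> norm (of_int (e k) :: complex) = 1"
  using signs_abs[of e k] by (metis norm_of_int of_int_1 of_int_abs)

lemma signs_shift: "e \<in> signs \<Longrightarrow> (\<lambda>k. e (k + n)) \<in> signs"
  by (simp add: signs_def)

lemma norm_series_term: "e \<in> signs \<Longrightarrow> norm (of_int (e k) * z ^ k :: complex) = norm z ^ k"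
  by (simp add: norm_mult norm_power norm_sign del: norm_of_int)

lemma summable_norm_series:
  "e \<in> signs \<Longrightarrow> norm z < 1 \<Longrightarrow> summable (\<lambda>k. norm (of_int (e k) * z ^ k :: complex))"
  by (simp add: norm_series_term summable_geometric)

lemma summable_series:
  "e \<in> signs \<Longrightarrow> norm z < 1 \<Longrightarrow> summable (\<lambda>k. of_int (e k) * z ^ k :: complex)"
  by (rule summable_norm_cancel[OF summable_norm_series])

lemma norm_series_le:
  assumes "e \<in> signs" "norm z \<le> \<rho>" "\<rho> < 1"
  shows "norm (series e z) \<le> 1 / (1 - \<rho>)"
proof -
  have z: "norm z < 1" using assms by simp
  have "norm (series e z) \<le> (\<Sum>k. norm (of_int (e k) * z ^ k :: complex))"
    unfolding series_def by (rule summable_norm[OF summable_norm_series[OF assms(1) z]])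
  also have "\<dots> = 1 / (1 - norm z)"
    using suminf_geometric[of "norm z"] z by (simp add: norm_series_term[OF assms(1)])
  also have "\<dots> \<le> 1 / (1 - \<rho>)"
    using assms z by (intro divide_left_mono) auto
  finally show ?thesis .
qed

lemma series_head:
  assumes "e \<in> signs" "norm z < 1"
  shows "series e z = of_int (e 0) + z * series (\<lambda>k. e (Suc k)) z"
proof -
  have s: "summable (\<lambda>k. of_int (e (Suc k)) * z ^ k)"
    using summable_series[OF signs_shift[OF assms(1), of 1] assms(2)] by simp
  have "(\<Sum>k. of_int (e (Suc k)) * z ^ Suc k) = z * series (\<lambda>k. e (Suc k)) z"
    unfolding series_def using suminf_mult[OF s, of z] by (simp add: mult_ac)
  then show ?thesis
    unfolding series_def using suminf_split_head[OF summable_series[OF assms]] by simp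
qed

lemma series_split:
  assumes "e \<in> signs" "norm z < 1"
  shows "series e z = horner (map e [0..<n]) z + z ^ n * series (\<lambda>k. e (k + n)) z"
  using assms(1)
proof (induction n arbitrary: e)
  case (Suc n)
  have m: "map e [0..<Suc n] = e 0 # map (\<lambda>k. e (Suc k)) [0..<n]"
    by (simp add: upt_conv_Cons map_Suc_upt[symmetric] del: upt_Suc)
  have "(\<lambda>k. e (Suc k)) \<in> signs" using signs_shift[OF Suc.prems, of 1] by simp
  from Suc.IH[OF this] show ?case
    unfolding m using series_head[OF Suc.prems assms(2)] by (simp add: algebra_simps)
qed simp

lemma norm_power_diff_le:
  fixes z w :: complex
  assumes "norm z \<le> \<rho>" "norm w \<le> \<rho>"
  shows "norm (z ^ n - w ^ n) \<le> real n * \<rho> ^ (n - 1) * norm (z - w)"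
proof (induction n)
  case (Suc n)
  have r: "0 \<le> \<rho>" using assms norm_ge_zero[of z] by linarith
  have "z ^ Suc n - w ^ Suc n = z * (z ^ n - w ^ n) + w ^ n * (z - w)"
    by (simp add: algebra_simps)
  then have "norm (z ^ Suc n - w ^ Suc n) \<le> norm z * norm (z ^ n - w ^ n) + norm w ^ n * norm (z - w)"
    by (metis norm_mult norm_power norm_triangle_ineq)
  also have "\<dots> \<le> \<rho> * (real n * \<rho> ^ (n - 1) * norm (z - w)) + \<rho> ^ n * norm (z - w)"
    using assms r Suc by (intro add_mono mult_mono power_mono) auto
  also have "\<dots> = real (Suc n) * \<rho> ^ (Suc n - 1) * norm (z - w)"
    by (cases n) (auto simp: algebra_simps)
  finally show ?case .
qed simp

lemma series_lipschitz:
  assumes "e \<in> signs" "norm z \<le> \<rho>" "norm w \<le> \<rho>" "\<rho> < 1"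
  shows "norm (series e z - series e w) \<le> norm (z - w) / (1 - \<rho>)\<^sup>2"
proof -
  have r: "0 \<le> \<rho>" using assms norm_ge_zero[of z] by linarith
  have zw: "norm z < 1" "norm w < 1" using assms by auto
  have d: "(\<lambda>n. real (Suc n) * \<rho> ^ n) sums (1 / (1 - \<rho>)\<^sup>2)"
    using geometric_deriv_sums[of \<rho>] r assms(4) by simp
  then have "(\<lambda>n. real n * \<rho> ^ (n - 1)) sums (1 / (1 - \<rho>)\<^sup>2)"
    using sums_Suc_iff[of "\<lambda>n. real n * \<rho> ^ (n - 1)" "1 / (1 - \<rho>)\<^sup>2"] by simp
  then have D: "(\<lambda>n. real n * \<rho> ^ (n - 1) * norm (z - w)) sums (norm (z - w) / (1 - \<rho>)\<^sup>2)"
    using sums_mult2 by fastforce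
  have "series e z - series e w = (\<Sum>k. of_int (e k) * z ^ k - of_int (e k) * w ^ k)"
    unfolding series_def by (rule suminf_diff) (use assms zw summable_series in auto)
  also have "norm \<dots> \<le> (\<Sum>n. real n * \<rho> ^ (n - 1) * norm (z - w))"
  proof (rule norm_suminf_le[OF _ sums_summable[OF D]])
    fix n
    have "norm (of_int (e n) * z ^ n - of_int (e n) * w ^ n :: complex) = norm (z ^ n - w ^ n)"
      using norm_sign[OF assms(1)] by (metis mult_1 norm_mult right_diff_distrib)
    also have "\<dots> \<le> real n * \<rho> ^ (n - 1) * norm (z - w)"
      by (rule norm_power_diff_le[OF assms(2,3)])
    finally show "norm (of_int (e n) * z ^ n - of_int (e n) * w ^ n :: complex)
        \<le> real n * \<rho> ^ (n - 1) * norm (z - w)" .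
  qed
  also have "\<dots> = norm (z - w) / (1 - \<rho>)\<^sup>2" using D by (rule sums_unique[symmetric])
  finally show ?thesis .
qed

lemma series_close:
  assumes "e \<in> signs" "e' \<in> signs" "map e [0..<n] = map e' [0..<n]" "norm z \<le> \<rho>" "\<rho> < 1"
  shows "norm (series e z - series e' z) \<le> 2 * \<rho> ^ n / (1 - \<rho>)"
proof -
  have z: "norm z < 1" using assms by simp
  have "series e z - series e' z
      = z ^ n * (series (\<lambda>k. e (k + n)) z - series (\<lambda>k. e' (k + n)) z)"
    using series_split[OF assms(1) z, of n] series_split[OF assms(2) z, of n] assms(3)
    by (simp add: algebra_simps)
  also have "norm \<dots> \<le> \<rho> ^ n * (1 / (1 - \<rho>) + 1 / (1 - \<rho>))"
    unfolding norm_mult norm_power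
    using norm_series_le[OF signs_shift[OF assms(1)] assms(4,5), of n]
      norm_series_le[OF signs_shift[OF assms(2)] assms(4,5), of n] assms(4)
      order_trans[OF norm_ge_zero assms(4)]
    by (intro mult_mono power_mono order_trans[OF norm_triangle_ineq4 add_mono]) auto
  finally show ?thesis by (simp add: mult.commute)
qed

section \<open>Cylinders of sign sequences and infinite branches\<close>

lemma cylinder_signs: "e \<in> cylinder u \<Longrightarrow> e \<in> signs"
  by (simp add: cylinder_def)

lemma cylinder_append_subset: "cylinder (u @ w) \<subseteq> cylinder u"
proof
  fix e assume e: "e \<in> cylinder (u @ w)"
  then have "map e [0..<length u + length w] = u @ w" by (simp add: cylinder_def)
  then have "take (length u) (map e [0..<length u + length w]) = u" by simp
  then show "e \<in> cylinder u" using e by (simp add: cylinder_def take_map)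
qed

lemma cylinder_snoc: "e \<in> cylinder u \<Longrightarrow> e \<in> cylinder (u @ [e (length u)])"
  by (simp add: cylinder_def)

text \<open>Stands in for compactness of the space of sign sequences: a property that survives some
  one-letter extension survives along an infinite word. It serves the closedness of zero sets, their
  connectedness and the closedness of the attractor.\<close>

lemma koenig:
  assumes "P u" and step: "\<And>v. P v \<Longrightarrow> \<exists>x. P (v @ [x])"
  obtains e :: "nat \<Rightarrow> 'a" where "map e [0..<length u] = u" "\<And>n. P (map e [0..<length u + n])"
proof -
  have "\<exists>f. \<forall>n. (P (f n) \<and> length (f n) = length u + n \<and> take (length u) (f n) = u)
      \<and> (\<exists>x. f (Suc n) = f n @ [x])"
  proof (rule dependent_nat_choice)
    show "\<exists>v. P v \<and> length v = length u + 0 \<and> take (length u) v = u"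
      using assms(1) by (intro exI[of _ u]) simp
    show "\<exists>w. (P w \<and> length w = length u + Suc n \<and> take (length u) w = u) \<and> (\<exists>x. w = v @ [x])"
      if "P v \<and> length v = length u + n \<and> take (length u) v = u" for v n
      using that step[of v] by fastforce
  qed
  then obtain f where f: "\<And>n. P (f n)" "\<And>n. length (f n) = length u + n"
      "\<And>n. take (length u) (f n) = u" "\<And>n. \<exists>x. f (Suc n) = f n @ [x]"
    by blast
  have stable: "f (i + d) ! k = f i ! k" if "k < length u + i" for i d k
  proof (induction d)
    case (Suc d)
    obtain x where "f (Suc (i + d)) = f (i + d) @ [x]" using f(4) by blast
    then show ?case using Suc that f(2)[of "i + d"] by (simp add: nth_append)
  qed simp
  \<comment> \<open>\<open>f (Suc k)\<close> has length at least \<open>Suc k\<close> even if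
    \<open>u\<close> is empty, so its letter \<open>k\<close> exists.\<close>
  define e where "e k = f (Suc k) ! k" for k
  have e: "map e [0..<length u + n] = f n" for n
  proof (rule nth_equalityI)
    fix k assume "k < length (map e [0..<length u + n])"
    then have k: "k < length u + n" by simp
    have "f (Suc k) ! k = f n ! k"
      using stable[of k "Suc k" "n - Suc k"] stable[of k n "Suc k - n"] k
      by (cases "Suc k \<le> n") auto
    then show "map e [0..<length u + n] ! k = f n ! k" using k by (simp add: e_def)
  qed (simp add: f(2))
  show thesis
  proof
    show "map e [0..<length u] = u"
      using e[of 0] f(3)[of 0] f(2)[of 0] by simp
    show "P (map e [0..<length u + n])" for n using e f(1) by simp
  qed
qed

definition sign_word :: "int list \<Rightarrow> bool" where
  "sign_word u \<longleftrightarrow> set u \<subseteq> {1, -1}"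

lemma prefixes_signs:
  assumes "\<And>n. sign_word (map e [0..<m + n])"
  shows "e \<in> signs"
proof -
  have "e k = 1 \<or> e k = -1" for k
  proof -
    have "e k \<in> set (map e [0..<m + Suc k])" by (auto intro!: imageI simp del: upt_Suc)
    then show ?thesis using assms[of "Suc k"] unfolding sign_word_def by blast
  qed
  then show ?thesis by (simp add: signs_def)
qed

section \<open>Zeros of series with a given prefix\<close>

definition zeros :: "int list \<Rightarrow> complex set \<Rightarrow> complex set" where
  "zeros u S = {z \<in> S. \<exists>e \<in> cylinder u. series e z = 0}"

lemma signs_values: "e \<in> signs \<Longrightarrow> e k = 1 \<or> e k = -1"
  by (simp add: signs_def)

lemma cylinder_split: "cylinder u = cylinder (u @ [1]) \<union> cylinder (u @ [-1])"
proof
  show "cylinder u \<subseteq> cylinder (u @ [1]) \<union> cylinder (u @ [-1])"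
  proof
    fix e assume e: "e \<in> cylinder u"
    then have "e (length u) = 1 \<or> e (length u) = -1"
      by (simp add: cylinder_signs signs_values)
    then show "e \<in> cylinder (u @ [1]) \<union> cylinder (u @ [-1])"
      using cylinder_snoc[OF e] by auto
  qed
  show "cylinder (u @ [1]) \<union> cylinder (u @ [-1]) \<subseteq> cylinder u"
    using cylinder_append_subset by blast
qed

lemma zeros_split: "zeros u S = zeros (u @ [1]) S \<union> zeros (u @ [-1]) S"
  using cylinder_split[of u] by (auto simp: zeros_def)

lemma sign_word_snoc: "sign_word u \<Longrightarrow> sign_word (u @ [1])" "sign_word u \<Longrightarrow> sign_word (u @ [-1])"
  by (auto simp: sign_word_def)

text \<open>A limit point is a limit of zeros belonging to one of the two halves at each further
  letter. Following these choices yields one series, whose value at the limit point is arbitrarily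
  small.\<close>

lemma closed_zeros:
  assumes S: "closed S" "S \<subseteq> cball 0 \<rho>" "\<rho> < 1" and rho: "0 < \<rho>" and u: "sign_word u"
  shows "closed (zeros u S)"
proof -
  have "z \<in> zeros u S" if z: "z \<in> closure (zeros u S)" for z
  proof -
    have zS: "z \<in> S"
      using z S(1) closure_minimal[of "zeros u S" S] by (auto simp: zeros_def)
    have rz: "norm w \<le> \<rho>" if "w \<in> S" for w using that S(2) by auto
    obtain e where e: "map e [0..<length u] = u"
        "\<And>n. z \<in> closure (zeros (map e [0..<length u + n]) S) \<and> sign_word (map e [0..<length u + n])"
    proof (rule koenig[of "\<lambda>v. z \<in> closure (zeros v S) \<and> sign_word v" u])
      show "\<exists>x. z \<in> closure (zeros (v @ [x]) S) \<and> sign_word (v @ [x])"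
        if v: "z \<in> closure (zeros v S) \<and> sign_word v" for v
      proof -
        have "z \<in> closure (zeros (v @ [1]) S) \<or> z \<in> closure (zeros (v @ [-1]) S)"
          using v zeros_split[of v S] by (simp add: closure_Un)
        then show ?thesis using v sign_word_snoc by blast
      qed
    qed (use z u in auto)
    have es: "e \<in> signs" using prefixes_signs e(2) by blast
    have bound: "norm (series e z) \<le> 3 * \<rho> ^ n / (1 - \<rho>)\<^sup>2" for n
    proof -
      let ?v = "map e [0..<length u + n]"
      \<comment> \<open>The distance \<rho>^n is chosen so that moving from \<open>w\<close> to
        \<open>z\<close> costs as much as replacing the tail.\<close>
      have "0 < \<rho> ^ n" using rho by simp
      then obtain w where w: "w \<in> zeros ?v S" "dist w z < \<rho> ^ n"
        using e(2)[of n] closure_approachable by blast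
      then obtain e' where e': "e' \<in> cylinder ?v" "series e' w = 0" "w \<in> S"
        by (auto simp: zeros_def)
      have s': "e' \<in> signs" using e'(1) cylinder_signs by blast
      have agree: "map e [0..<length u + n] = map e' [0..<length u + n]"
        using e'(1) by (simp add: cylinder_def)
      have "norm (series e z - series e' z) \<le> 2 * \<rho> ^ (length u + n) / (1 - \<rho>)"
        by (rule series_close[OF es s' agree rz[OF zS] S(3)])
      also have "\<dots> \<le> 2 * \<rho> ^ n / (1 - \<rho>)\<^sup>2"
      proof -
        have "\<rho> ^ (length u + n) \<le> \<rho> ^ n" using rho S(3) by (intro power_decreasing) auto
        moreover have "(1 - \<rho>)\<^sup>2 \<le> 1 - \<rho>"
          using rho S(3) by (simp add: power2_eq_square mult_left_le)
        ultimately show ?thesis using rho S(3) by (intro frac_le) auto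
      qed
      finally have 1: "norm (series e z - series e' z) \<le> 2 * \<rho> ^ n / (1 - \<rho>)\<^sup>2" .
      have "norm (series e' z - series e' w) \<le> norm (z - w) / (1 - \<rho>)\<^sup>2"
        by (rule series_lipschitz[OF s' rz[OF zS] rz[OF e'(3)] S(3)])
      also have "\<dots> \<le> \<rho> ^ n / (1 - \<rho>)\<^sup>2"
        using w(2) by (intro divide_right_mono) (auto simp: dist_norm norm_minus_commute)
      finally have 2: "norm (series e' z) \<le> \<rho> ^ n / (1 - \<rho>)\<^sup>2" using e'(2) by simp
      have "norm (series e z) \<le> norm (series e z - series e' z) + norm (series e' z)"
        by (metis add.commute norm_triangle_sub)
      with 1 2 show ?thesis by (simp add: add_divide_distrib)
    qed
    have "(\<lambda>n. 3 * \<rho> ^ n / (1 - \<rho>)\<^sup>2) \<longlonglongrightarrow> 3 * 0 / (1 - \<rho>)\<^sup>2"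
      using rho S(3) by (intro tendsto_intros LIMSEQ_realpow_zero) auto
    then have "norm (series e z) \<le> 0"
      using bound by (intro LIMSEQ_le_const[where X = "\<lambda>n. 3 * \<rho> ^ n / (1 - \<rho>)\<^sup>2"]) auto
    then have "series e z = 0" by simp
    moreover have "e \<in> cylinder u" using e(1) es by (simp add: cylinder_def)
    ultimately show ?thesis using zS by (auto simp: zeros_def)
  qed
  then show ?thesis using closure_subset_eq by blast
qed

section \<open>Periodic series and zeros of polynomials\<close>

lemma horner_append:
  "horner (xs @ ys) z = horner xs z + z ^ length xs * horner ys z"
  by (induction xs) (auto simp: algebra_simps)

lemma horner_uminus: "horner (map uminus xs) z = - horner xs z"
  by (induction xs) (auto simp: algebra_simps)

definition periodic :: "int list \<Rightarrow> nat \<Rightarrow> int" where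
  "periodic w k = w ! (k mod length w)"

lemma map_periodic: "map (periodic w) [0..<length w] = w"
  by (rule nth_equalityI) (auto simp: periodic_def)

lemma sign_word_nth: "sign_word u \<Longrightarrow> k < length u \<Longrightarrow> u ! k = 1 \<or> u ! k = -1"
  unfolding sign_word_def using nth_mem by blast

lemma periodic_signs: "sign_word w \<Longrightarrow> w \<noteq> [] \<Longrightarrow> periodic w \<in> signs"
  unfolding signs_def periodic_def by (simp add: sign_word_nth)

lemma series_periodic:
  assumes "sign_word w" "w \<noteq> []" "norm z < 1"
  shows "(1 - z ^ length w) * series (periodic w) z = horner w z"
proof -
  have "(\<lambda>k. periodic w (k + length w)) = periodic w" by (auto simp: periodic_def)
  then show ?thesis
    using series_split[OF periodic_signs[OF assms(1,2)] assms(3), of "length w"]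
    by (simp add: map_periodic algebra_simps)
qed

lemma one_minus_power_nonzero:
  fixes z :: complex
  assumes "norm z < 1" "n \<noteq> 0"
  shows "1 - z ^ n \<noteq> 0"
proof
  assume "1 - z ^ n = 0"
  then have "norm z ^ n = 1" by (metis eq_iff_diff_eq_0 norm_one norm_power)
  then show False using assms power_strict_mono[of "norm z" 1 n] by simp
qed

text \<open>Repeating \<open>w\<close> for ever gives the series w / (1 - z^|w|), which vanishes
  wherever the polynomial \<open>w\<close> does. Zeros of finite words thus become points of the
  zero sets.\<close>

lemma horner_zero_in_zeros:
  assumes "sign_word w" "u \<noteq> []" "take (length u) w = u" "horner w z = 0" "z \<in> S" "norm z < 1"
  shows "z \<in> zeros u S"
proof -
  have w: "w \<noteq> []" using assms(2,3) by auto
  have "series (periodic w) z = 0"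
    using series_periodic[OF assms(1) w assms(6)] assms(4) one_minus_power_nonzero[OF assms(6), of "length w"] w
    by simp
  moreover have "periodic w \<in> cylinder u"
  proof -
    have "w = u @ drop (length u) w" using assms(3) by (metis append_take_drop_id)
    moreover have "periodic w \<in> cylinder w"
      using periodic_signs[OF assms(1) w] by (simp add: cylinder_def map_periodic)
    ultimately show ?thesis using cylinder_append_subset by (metis subsetD)
  qed
  ultimately show ?thesis using assms(5) by (auto simp: zeros_def)
qed

text \<open>The lower Lipschitz bound, uniform over the cylinder, is more than uniqueness of the
  zero: two series that are close then have zeros that are close.\<close>

definition isolates :: "int list \<Rightarrow> complex set \<Rightarrow> bool" where
  "isolates u S \<longleftrightarrow> (\<exists>\<mu>>0. \<forall>e \<in> cylinder u. (\<exists>z\<in>S. series e z = 0) \<and>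
     (\<forall>z\<in>S. \<forall>w\<in>S. \<mu> * norm (z - w) \<le> norm (series e z - series e w)))"

text \<open>The zero of the periodic series of \<open>v\<close> is a zero of the polynomial
  \<open>v\<close>, hence of \<open>v @ v\<close> and of \<open>v @ map uminus v\<close>. Their
  letters right after \<open>v\<close> are \<open>hd v\<close> and \<open>- hd v\<close>, that is 1
  and -1 in some order.\<close>

lemma sibling_zeros_meet:
  assumes v: "sign_word v" "v \<noteq> []" and S: "S \<subseteq> ball 0 1"
    and ex: "\<And>e. e \<in> cylinder v \<Longrightarrow> \<exists>z\<in>S. series e z = 0"
  shows "zeros (v @ [1]) S \<inter> zeros (v @ [-1]) S \<noteq> {}"
proof -
  have "periodic v \<in> cylinder v"
    using periodic_signs[OF v] by (simp add: cylinder_def map_periodic)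
  from ex[OF this] obtain z where z: "z \<in> S" "series (periodic v) z = 0" by blast
  have nz: "norm z < 1" using z(1) S by auto
  have hz: "horner v z = 0" using series_periodic[OF v nz] z(2) by simp
  have mu: "sign_word (map uminus v)" using v(1) by (auto simp: sign_word_def)
  have "z \<in> zeros (v @ [hd v]) S"
  proof (rule horner_zero_in_zeros[of "v @ v"])
    show "take (length (v @ [hd v])) (v @ v) = v @ [hd v]" using v(2) by (cases v) auto
  qed (use v z nz hz in \<open>auto simp: horner_append sign_word_def\<close>)
  moreover have "z \<in> zeros (v @ [- hd v]) S"
  proof (rule horner_zero_in_zeros[of "v @ map uminus v"])
    show "take (length (v @ [- hd v])) (v @ map uminus v) = v @ [- hd v]" using v(2) by (cases v) auto
  qed (use v z nz hz mu in \<open>auto simp: horner_append horner_uminus sign_word_def\<close>)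
  moreover have "hd v = 1 \<or> hd v = -1" using v by (cases v) (auto simp: sign_word_def)
  ultimately show ?thesis by auto
qed

text \<open>Suppose open sets \<open>A\<close>, \<open>B\<close> separate the zeros, and call a
  prefix mixed if its zeros meet both. The common point of the two halves of a mixed prefix lies in
  one of the sets, say \<open>A\<close>; the half that meets \<open>B\<close> is then mixed too.
  This yields a series all of whose prefixes are mixed, although their zeros shrink to its single
  zero, which has a neighbourhood \<open>A\<close> or \<open>B\<close>.\<close>

theorem connected_zeros:
  assumes S: "S \<subseteq> cball 0 \<rho>" "\<rho> < 1" and u: "sign_word u" "u \<noteq> []" and iso: "isolates u S"
  shows "connected (zeros u S)"
  unfolding connected_def
proof
  assume "\<exists>A B. open A \<and> open B \<and> zeros u S \<subseteq> A \<union> B \<and> A \<inter> B \<inter> zeros u S = {}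
      \<and> A \<inter> zeros u S \<noteq> {} \<and> B \<inter> zeros u S \<noteq> {}"
  then obtain A B where AB: "open A" "open B" "zeros u S \<subseteq> A \<union> B" "A \<inter> B \<inter> zeros u S = {}"
      "A \<inter> zeros u S \<noteq> {}" "B \<inter> zeros u S \<noteq> {}"
    by blast
  obtain \<mu> where \<mu>: "\<mu> > 0" "\<And>e. e \<in> cylinder u \<Longrightarrow> \<exists>z\<in>S. series e z = 0"
      "\<And>e z w. e \<in> cylinder u \<Longrightarrow> z \<in> S \<Longrightarrow> w \<in> S \<Longrightarrow>
        \<mu> * norm (z - w) \<le> norm (series e z - series e w)"
    using iso unfolding isolates_def by blast
  have S1: "S \<subseteq> ball 0 1" using S by auto
  define mixed where "mixed v \<longleftrightarrow> sign_word v \<and> (\<exists>w. v = u @ w) \<and> A \<inter> zeros v S \<noteq> {} \<and> B \<inter> zeros v S \<noteq> {}" for v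
  have sub: "cylinder v \<subseteq> cylinder u" "zeros v S \<subseteq> zeros u S" if "\<exists>w. v = u @ w" for v
    using that cylinder_append_subset by (auto simp: zeros_def)
  obtain e where e: "map e [0..<length u] = u" "\<And>n. mixed (map e [0..<length u + n])"
  proof (rule koenig[of mixed u])
    show "mixed u" using AB(5,6) u by (auto simp: mixed_def)
    show "\<exists>x. mixed (v @ [x])" if v: "mixed v" for v
    proof -
      have ext: "\<exists>w. v = u @ w" and sv: "sign_word v" using v by (auto simp: mixed_def)
      then have "zeros (v @ [1]) S \<inter> zeros (v @ [-1]) S \<noteq> {}"
        using u(2) \<mu>(2) sub(1)[OF ext] by (intro sibling_zeros_meet[OF _ _ S1]) auto
      then obtain z where z: "z \<in> zeros (v @ [1]) S" "z \<in> zeros (v @ [-1]) S" by blast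
      then have "z \<in> A \<union> B" using zeros_split[of v S] sub(2)[OF ext] AB(3) by blast
      moreover have "\<exists>w. v @ [x] = u @ w" for x using ext by auto
      moreover have "A \<inter> (zeros (v @ [1]) S \<union> zeros (v @ [-1]) S) \<noteq> {}"
        "B \<inter> (zeros (v @ [1]) S \<union> zeros (v @ [-1]) S) \<noteq> {}"
        using v zeros_split[of v S] by (auto simp: mixed_def)
      ultimately have "mixed (v @ [1]) \<or> mixed (v @ [-1])"
        unfolding mixed_def using z sign_word_snoc[OF sv] by blast
      then show ?thesis by blast
    qed
  qed auto
  have es: "e \<in> signs" using prefixes_signs e(2) unfolding mixed_def by blast
  then have eu: "e \<in> cylinder u" using e(1) by (simp add: cylinder_def)
  obtain \<zeta> where \<zeta>: "\<zeta> \<in> S" "series e \<zeta> = 0" using \<mu>(2)[OF eu] by blast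
  \<comment> \<open>Any competing series \<open>e'\<close> is small at \<zeta>'s rivals only up to
    its tail, and \<mu> converts this tail bound into a bound on the distance to \<zeta>.\<close>
  have shrink: "\<exists>n. zeros (map e [0..<length u + n]) S \<subseteq> X" if X: "open X" "\<zeta> \<in> X" for X
  proof -
    obtain r where r: "r > 0" "ball \<zeta> r \<subseteq> X" using X open_contains_ball by blast
    have rho: "0 \<le> \<rho>" using \<zeta>(1) S(1) norm_ge_zero[of \<zeta>] by (metis mem_cball_0 order_trans subsetD)
    have "(\<lambda>n. 2 * \<rho> ^ (length u + n) / (1 - \<rho>)) \<longlonglongrightarrow> 2 * 0 / (1 - \<rho>)"
      unfolding power_add using rho S(2)
      by (intro tendsto_intros tendsto_mult_right_zero LIMSEQ_realpow_zero) auto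
    then have "\<forall>\<^sub>F n in sequentially. 2 * \<rho> ^ (length u + n) / (1 - \<rho>) < \<mu> * r"
      using \<mu>(1) r(1) by (intro order_tendstoD) auto
    then obtain n where n: "2 * \<rho> ^ (length u + n) / (1 - \<rho>) < \<mu> * r"
      by (auto simp: eventually_sequentially)
    have "w \<in> X" if w: "w \<in> zeros (map e [0..<length u + n]) S" for w
    proof -
      obtain e' where e': "e' \<in> cylinder (map e [0..<length u + n])" "series e' w = 0" "w \<in> S"
        using w by (auto simp: zeros_def)
      have "map e [0..<length u + n] = map e' [0..<length u + n]"
        using e'(1) by (simp add: cylinder_def)
      then have "norm (series e w - series e' w) \<le> 2 * \<rho> ^ (length u + n) / (1 - \<rho>)"
        using e'(1,3) S es by (intro series_close) (auto simp: cylinder_signs)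
      then have "\<mu> * norm (w - \<zeta>) < \<mu> * r"
        using \<mu>(3)[OF eu e'(3) \<zeta>(1)] \<zeta>(2) e'(2) n by simp
      then have "norm (w - \<zeta>) < r" using \<mu>(1) by simp
      then show ?thesis using r(2) by (auto simp: dist_norm norm_minus_commute)
    qed
    then show ?thesis by blast
  qed
  have "\<zeta> \<in> zeros u S" using eu \<zeta> by (auto simp: zeros_def)
  then have "\<zeta> \<in> A \<or> \<zeta> \<in> B" using AB(3) by blast
  then obtain n where n: "zeros (map e [0..<length u + n]) S \<subseteq> A \<or> zeros (map e [0..<length u + n]) S \<subseteq> B"
    using shrink AB(1,2) by blast
  then show False
    using e(2)[of n] AB(4) sub(2)[of "map e [0..<length u + n]"] unfolding mixed_def by blast
qed

section \<open>Discs isolating one zero\<close>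

text \<open>The Newton map with frozen slope \<open>c\<close> contracts with factor L / |c|, and the
  bound on \<open>f a\<close> makes it map the ball into itself.\<close>

lemma newton_zero:
  fixes f :: "complex \<Rightarrow> complex"
  assumes lin: "\<And>z w. z \<in> cball a R \<Longrightarrow> w \<in> cball a R \<Longrightarrow>
      norm (f z - f w - c * (z - w)) \<le> L * norm (z - w)"
    and L: "0 \<le> L" "L < norm c" and R: "0 \<le> R" and fa: "norm (f a) \<le> (norm c - L) * R"
  shows "\<exists>z \<in> cball a R. f z = 0"
proof -
  have c: "c \<noteq> 0" "0 < norm c" using L by auto
  define T where "T z = z - f z / c" for z
  have Tlin: "norm (T z - T w) \<le> L / norm c * norm (z - w)"
    if "z \<in> cball a R" "w \<in> cball a R" for z w
  proof -
    have "T z - T w = - (f z - f w - c * (z - w)) / c"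
      unfolding T_def using c by (simp add: field_simps)
    then have "norm (T z - T w) = norm (f z - f w - c * (z - w)) / norm c"
      by (simp add: norm_divide norm_minus_commute)
    also have "\<dots> \<le> L * norm (z - w) / norm c"
      using lin[OF that] by (intro divide_right_mono) auto
    finally show ?thesis by simp
  qed
  have "T z \<in> cball a R" if z: "z \<in> cball a R" for z
  proof -
    have "norm (T z - a) \<le> norm (T z - T a) + norm (T a - a)"
      using norm_triangle_ineq[of "T z - T a" "T a - a"] by simp
    also have "\<dots> \<le> L / norm c * norm (z - a) + norm (f a) / norm c"
      using Tlin[OF z, of a] R by (simp add: T_def norm_divide)
    also have "\<dots> \<le> L / norm c * R + (norm c - L) * R / norm c"
      using z fa L c by (intro add_mono mult_left_mono divide_right_mono)
        (auto simp: dist_norm norm_minus_commute)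
    also have "\<dots> = R" using c by (simp add: field_simps)
    finally show ?thesis by (simp add: dist_norm norm_minus_commute)
  qed
  then have "\<exists>!z\<in>cball a R. T z = z"
    using L c R Tlin
    by (intro Banach_fix[of _ "L / norm c"]) (auto simp: complete_eq_closed dist_norm simp del: times_divide_eq_left)
  then obtain z where "z \<in> cball a R" "T z = z" by blast
  then show ?thesis using c by (auto simp: T_def)
qed

definition small_word :: "int list \<Rightarrow> bool" where
  "small_word u \<longleftrightarrow> (\<forall>x\<in>set u. \<bar>x\<bar> \<le> 1)"

lemma small_word_Cons: "small_word (x # xs) \<Longrightarrow> small_word xs \<and> norm (of_int x :: complex) \<le> 1"
  by (simp add: small_word_def) linarith

context
  fixes \<rho> :: real
  assumes \<rho>: "0 \<le> \<rho>" "\<rho> < 1"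
begin

lemma geometric_square_identity: "\<rho> * (1 / (1 - \<rho>)\<^sup>2) + 1 / (1 - \<rho>) = 1 / (1 - \<rho>)\<^sup>2"
proof -
  have "1 / (1 - \<rho>) = (1 - \<rho>) / (1 - \<rho>)\<^sup>2" using \<rho> by (simp add: power2_eq_square)
  then show ?thesis by (simp flip: add_divide_distrib)
qed

lemma norm_horner_le:
  "small_word xs \<Longrightarrow> norm z \<le> \<rho> \<Longrightarrow> norm (horner xs z) \<le> 1 / (1 - \<rho>)"
proof (induction xs)
  case (Cons x xs)
  have "norm (horner (x # xs) z) \<le> norm (of_int x :: complex) + norm z * norm (horner xs z)"
    by (metis horner.simps(2) norm_mult norm_triangle_ineq)
  also have "\<dots> \<le> 1 + \<rho> * (1 / (1 - \<rho>))"
    using Cons small_word_Cons[OF Cons.prems(1)] \<rho> by (intro add_mono mult_mono) auto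
  also have "\<dots> = 1 / (1 - \<rho>)" using \<rho> by (simp add: field_simps)
  finally show ?case .
qed (use \<rho> in simp)

lemma norm_dhorner_le:
  "small_word xs \<Longrightarrow> norm z \<le> \<rho> \<Longrightarrow> norm (dhorner xs z) \<le> 1 / (1 - \<rho>)\<^sup>2"
proof (induction xs)
  case (Cons x xs)
  have "norm (dhorner (x # xs) z) \<le> norm (horner xs z) + norm z * norm (dhorner xs z)"
    by (metis dhorner.simps(2) norm_mult norm_triangle_ineq)
  also have "\<dots> \<le> 1 / (1 - \<rho>) + \<rho> * (1 / (1 - \<rho>)\<^sup>2)"
    using Cons small_word_Cons[OF Cons.prems(1)] \<rho> norm_horner_le
    by (intro add_mono mult_mono) auto
  also have "\<dots> = 1 / (1 - \<rho>)\<^sup>2" using geometric_square_identity by linarith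
  finally show ?case .
qed (use \<rho> in simp)

lemma horner_lipschitz:
  "small_word xs \<Longrightarrow> norm z \<le> \<rho> \<Longrightarrow> norm w \<le> \<rho> \<Longrightarrow>
    norm (horner xs z - horner xs w) \<le> 1 / (1 - \<rho>)\<^sup>2 * norm (z - w)"
proof (induction xs)
  case (Cons x xs)
  have "horner (x # xs) z - horner (x # xs) w
      = z * (horner xs z - horner xs w) + horner xs w * (z - w)"
    by (simp add: algebra_simps)
  then have "norm (horner (x # xs) z - horner (x # xs) w)
      \<le> norm z * norm (horner xs z - horner xs w) + norm (horner xs w) * norm (z - w)"
    by (metis norm_mult norm_triangle_ineq)
  also have "\<dots> \<le> \<rho> * (1 / (1 - \<rho>)\<^sup>2 * norm (z - w)) + 1 / (1 - \<rho>) * norm (z - w)"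
    using Cons small_word_Cons[OF Cons.prems(1)] \<rho> norm_horner_le
    by (intro add_mono mult_mono) auto
  also have "\<dots> = (\<rho> * (1 / (1 - \<rho>)\<^sup>2) + 1 / (1 - \<rho>)) * norm (z - w)"
    by (simp add: algebra_simps)
  also note geometric_square_identity
  finally show ?case .
qed simp

text \<open>The constant is R times 2 / (1 - \<rho>)^3, the sum of k (k - 1) \<rho>^(k - 2), which
  bounds the second derivative of every such polynomial whatever its length.\<close>

lemma horner_linearization:
  assumes "norm z \<le> \<rho>" "norm w \<le> \<rho>" "norm a \<le> \<rho>" "norm (z - a) \<le> R" "norm (w - a) \<le> R"
  shows "small_word xs \<Longrightarrow>
    norm (horner xs z - horner xs w - dhorner xs a * (z - w)) \<le> 2 * R / (1 - \<rho>) ^ 3 * norm (z - w)"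
proof (induction xs)
  case Nil
  have "0 \<le> R" using assms(4) norm_ge_zero order_trans by blast
  then show ?case using \<rho> by simp
next
  case (Cons x xs)
  have R: "0 \<le> R" using assms(4) norm_ge_zero order_trans by blast
  have s: "small_word xs" using small_word_Cons[OF Cons.prems] by simp
  let ?E = "horner xs z - horner xs w - dhorner xs a * (z - w)"
  have "horner (x # xs) z - horner (x # xs) w - dhorner (x # xs) a * (z - w)
      = z * ?E + ((horner xs w - horner xs a) + dhorner xs a * (z - a)) * (z - w)"
    by (simp add: algebra_simps)
  then have "norm (horner (x # xs) z - horner (x # xs) w - dhorner (x # xs) a * (z - w))
      \<le> norm z * norm ?E + norm ((horner xs w - horner xs a) + dhorner xs a * (z - a)) * norm (z - w)"
    by (metis norm_mult norm_triangle_ineq)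
  also have "\<dots> \<le> \<rho> * (2 * R / (1 - \<rho>) ^ 3 * norm (z - w)) + 2 * R / (1 - \<rho>)\<^sup>2 * norm (z - w)"
  proof (intro add_mono mult_mono)
    have "norm ((horner xs w - horner xs a) + dhorner xs a * (z - a))
        \<le> norm (horner xs w - horner xs a) + norm (dhorner xs a) * norm (z - a)"
      by (metis norm_mult norm_triangle_ineq)
    also have "\<dots> \<le> 1 / (1 - \<rho>)\<^sup>2 * R + 1 / (1 - \<rho>)\<^sup>2 * R"
    proof (intro add_mono mult_mono)
      have "norm (horner xs w - horner xs a) \<le> 1 / (1 - \<rho>)\<^sup>2 * norm (w - a)"
        by (rule horner_lipschitz[OF s assms(2,3)])
      also have "\<dots> \<le> 1 / (1 - \<rho>)\<^sup>2 * R" by (intro mult_left_mono assms) simp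
      finally show "norm (horner xs w - horner xs a) \<le> 1 / (1 - \<rho>)\<^sup>2 * R" .
    qed (use assms norm_dhorner_le[OF s] R in auto)
    finally show "norm ((horner xs w - horner xs a) + dhorner xs a * (z - a)) \<le> 2 * R / (1 - \<rho>)\<^sup>2"
      by simp
  qed (use Cons.IH[OF s] assms \<rho> R in auto)
  also have "\<dots> = (\<rho> * (2 * R / (1 - \<rho>) ^ 3) + 2 * R / (1 - \<rho>)\<^sup>2) * norm (z - w)"
    by (simp add: algebra_simps)
  also have "\<rho> * (2 * R / (1 - \<rho>) ^ 3) + 2 * R / (1 - \<rho>)\<^sup>2 = 2 * R / (1 - \<rho>) ^ 3"
  proof -
    have "2 * R / (1 - \<rho>)\<^sup>2 = 2 * R * (1 - \<rho>) / (1 - \<rho>) ^ 3"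
      using \<rho> by (simp add: power2_eq_square power3_eq_cube)
    then show ?thesis by (simp add: algebra_simps flip: add_divide_distrib)
  qed
  finally show ?case .
qed

lemma horner_zero_near:
  assumes xs: "small_word xs" and a: "norm a + R \<le> \<rho>" "0 \<le> R"
    and \<kappa>: "\<kappa> \<le> norm (dhorner xs a)" "2 * R / (1 - \<rho>) ^ 3 < \<kappa>"
    and \<delta>: "norm (horner xs a) \<le> (\<kappa> - 2 * R / (1 - \<rho>) ^ 3) * R"
  shows "\<exists>z \<in> cball a R. horner xs z = 0"
proof (rule newton_zero[where c = "dhorner xs a" and L = "2 * R / (1 - \<rho>) ^ 3"])
  have in\<rho>: "norm z \<le> \<rho>" if "z \<in> cball a R" for z
    using that a(1) norm_triangle_sub[of z a] by (auto simp: dist_norm norm_minus_commute)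
  show "norm (horner xs z - horner xs w - dhorner xs a * (z - w)) \<le> 2 * R / (1 - \<rho>) ^ 3 * norm (z - w)"
    if "z \<in> cball a R" "w \<in> cball a R" for z w
    using that in\<rho> a xs by (intro horner_linearization) (auto simp: dist_norm norm_minus_commute)
  show "norm (horner xs a) \<le> (norm (dhorner xs a) - 2 * R / (1 - \<rho>) ^ 3) * R"
    by (rule order_trans[OF \<delta>]) (use \<kappa> a in \<open>auto intro!: mult_right_mono\<close>)
qed (use \<kappa> \<rho> a in auto)

lemma isolates_cball:
  assumes L: "2 * R / (1 - \<rho>) ^ 3 + real (length u) * \<rho> ^ (length u - 1) / (1 - \<rho>)
      + \<rho> ^ length u / (1 - \<rho>)\<^sup>2 \<le> L"
    and u: "sign_word u" and a: "norm a + R \<le> \<rho>" "0 \<le> R"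
    and \<kappa>: "\<kappa> \<le> norm (dhorner u a)" "L < \<kappa>"
    and \<delta>: "norm (horner u a) \<le> \<delta>" "\<delta> + \<rho> ^ length u / (1 - \<rho>) \<le> (\<kappa> - L) * R"
  shows "isolates u (cball a R)"
proof -
  let ?m = "length u" and ?c = "dhorner u a"
  have in\<rho>: "norm z \<le> \<rho>" if "z \<in> cball a R" for z
    using that a(1) norm_triangle_sub[of z a] by (auto simp: dist_norm norm_minus_commute)
  have s: "small_word u" using u by (auto simp: small_word_def sign_word_def)
  have L0: "0 \<le> L" using \<rho> a(2) by (intro order_trans[OF _ L]) simp
  have lin: "norm (series e z - series e w - ?c * (z - w)) \<le> L * norm (z - w)"
    if e: "e \<in> cylinder u" and z: "z \<in> cball a R" and w: "w \<in> cball a R" for e z w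
  proof -
    define t where "t = (\<lambda>k. e (k + ?m))"
    have es: "e \<in> signs" and pre: "map e [0..<?m] = u" using e by (auto simp: cylinder_def)
    have ts: "t \<in> signs" unfolding t_def by (rule signs_shift[OF es])
    have sp: "series e y = horner u y + y ^ ?m * series t y" if "norm y < 1" for y
      using series_split[OF es that, of ?m] pre by (simp add: t_def)
    have nz: "norm z \<le> \<rho>" "norm w \<le> \<rho>" using z w in\<rho> by auto
    \<comment> \<open>The three sources of nonlinearity, namely the word, the power in front of the
      tail and the tail, give the three summands of \<open>L\<close>.\<close>
    have "series e z - series e w - ?c * (z - w) = (horner u z - horner u w - ?c * (z - w))
        + (z ^ ?m - w ^ ?m) * series t z + w ^ ?m * (series t z - series t w)"
      using sp[of z] sp[of w] nz \<rho> by (simp add: algebra_simps)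
    then have "norm (series e z - series e w - ?c * (z - w))
        \<le> norm (horner u z - horner u w - ?c * (z - w))
          + norm (z ^ ?m - w ^ ?m) * norm (series t z) + norm w ^ ?m * norm (series t z - series t w)"
      by (simp only:) (intro order_trans[OF norm_triangle_ineq] add_mono; simp add: norm_mult norm_power)
    also have "\<dots> \<le> 2 * R / (1 - \<rho>) ^ 3 * norm (z - w)
        + (real ?m * \<rho> ^ (?m - 1) * norm (z - w)) * (1 / (1 - \<rho>)) + \<rho> ^ ?m * (norm (z - w) / (1 - \<rho>)\<^sup>2)"
    proof (intro add_mono mult_mono)
      show "norm (horner u z - horner u w - ?c * (z - w)) \<le> 2 * R / (1 - \<rho>) ^ 3 * norm (z - w)"
        using z w nz a s by (intro horner_linearization) (auto simp: dist_norm norm_minus_commute)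
      show "norm (z ^ ?m - w ^ ?m) \<le> real ?m * \<rho> ^ (?m - 1) * norm (z - w)"
        by (rule norm_power_diff_le[OF nz])
      show "norm (series t z) \<le> 1 / (1 - \<rho>)" by (rule norm_series_le[OF ts nz(1) \<rho>(2)])
      show "norm (series t z - series t w) \<le> norm (z - w) / (1 - \<rho>)\<^sup>2"
        by (rule series_lipschitz[OF ts nz \<rho>(2)])
    qed (use nz \<rho> in \<open>auto intro: power_mono\<close>)
    also have "\<dots> = (2 * R / (1 - \<rho>) ^ 3 + real ?m * \<rho> ^ (?m - 1) / (1 - \<rho>)
        + \<rho> ^ ?m / (1 - \<rho>)\<^sup>2) * norm (z - w)"
      by (simp add: algebra_simps)
    also have "\<dots> \<le> L * norm (z - w)" using L by (intro mult_right_mono) auto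
    finally show ?thesis .
  qed
  have ex: "\<exists>z \<in> cball a R. series e z = 0" if e: "e \<in> cylinder u" for e
  proof (rule newton_zero[where c = ?c and L = L])
    have es: "e \<in> signs" and pre: "map e [0..<?m] = u" using e by (auto simp: cylinder_def)
    have na: "norm a \<le> \<rho>" using a by simp
    have "series e a = horner u a + a ^ ?m * series (\<lambda>k. e (k + ?m)) a"
      using series_split[OF es, of a ?m] pre na \<rho> by simp
    then have "norm (series e a) \<le> norm (horner u a) + norm a ^ ?m * norm (series (\<lambda>k. e (k + ?m)) a)"
      by (metis norm_mult norm_power norm_triangle_ineq)
    also have "\<dots> \<le> \<delta> + \<rho> ^ ?m * (1 / (1 - \<rho>))"
      using \<delta>(1) na \<rho> norm_series_le[OF signs_shift[OF es] na \<rho>(2)]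
      by (intro add_mono mult_mono power_mono) auto
    also have "\<dots> \<le> (\<kappa> - L) * R" using \<delta>(2) by simp
    also have "\<dots> \<le> (norm ?c - L) * R" using \<kappa>(1) a(2) by (intro mult_right_mono) auto
    finally show "norm (series e a) \<le> (norm ?c - L) * R" .
  qed (use lin[OF e] L0 \<kappa> a in auto)
  have "(\<kappa> - L) * norm (z - w) \<le> norm (series e z - series e w)"
    if "e \<in> cylinder u" "z \<in> cball a R" "w \<in> cball a R" for e z w
  proof -
    have "norm (?c * (z - w)) \<le> norm (series e z - series e w) + norm (series e z - series e w - ?c * (z - w))"
      using norm_triangle_ineq4[of "series e z - series e w" "series e z - series e w - ?c * (z - w)"] by simp
    then have "norm ?c * norm (z - w) \<le> norm (series e z - series e w) + L * norm (z - w)"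
      using lin[OF that] by (simp add: norm_mult)
    moreover have "\<kappa> * norm (z - w) \<le> norm ?c * norm (z - w)" using \<kappa>(1) by (intro mult_right_mono) auto
    ultimately show ?thesis by (simp add: algebra_simps)
  qed
  then show ?thesis unfolding isolates_def using ex \<kappa>(2) by (intro exI[of _ "\<kappa> - L"]) auto
qed

end

section \<open>Two arcs around a point\<close>

text \<open>Having a continuous logarithm of (x - b) / (x - a) on \<open>K\<close> is an equivalence
  relation between \<open>a\<close> and \<open>b\<close>. It holds locally: if \<open>b\<close> is
  nearer to \<open>a\<close> than \<open>K\<close> is, the quotient stays in the right half-plane,
  where \<open>Ln\<close> is continuous. Connectedness of \<open>C\<close> does the rest.\<close>

lemma continuous_log_quotient:
  fixes K C :: "complex set"
  assumes K: "closed K" and C: "connected C" "C \<inter> K = {}" and yw: "w \<in> C" "y \<in> C"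
  shows "\<exists>g. continuous_on K g \<and> (\<forall>x\<in>K. x - y = (x - w) * exp (g x))"
proof -
  define Q where "Q a b \<longleftrightarrow> (\<exists>g. continuous_on K g \<and> (\<forall>x\<in>K. x - b = (x - a) * exp (g x)))" for a b
  have "Q w y"
  proof (rule connected_equivalence_relation[OF C(1) yw])
    show "Q b a" if ab: "Q a b" for a b
    proof -
      obtain g where g: "continuous_on K g" "\<And>x. x \<in> K \<Longrightarrow> x - b = (x - a) * exp (g x)"
        using ab unfolding Q_def by blast
      have "x - a = (x - b) * exp (- g x)" if "x \<in> K" for x
        using g(2)[OF that] by (simp add: exp_minus)
      then show ?thesis
        unfolding Q_def using g(1) by (intro exI[of _ "\<lambda>x. - g x"]) (auto intro: continuous_intros)
    qed
    show "Q a c" if ab: "Q a b" and bc: "Q b c" for a b c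
    proof -
      obtain g h where g: "continuous_on K g" "\<And>x. x \<in> K \<Longrightarrow> x - b = (x - a) * exp (g x)"
        and h: "continuous_on K h" "\<And>x. x \<in> K \<Longrightarrow> x - c = (x - b) * exp (h x)"
        using ab bc unfolding Q_def by blast
      have "x - c = (x - a) * exp (g x + h x)" if "x \<in> K" for x
        using g(2)[OF that] h(2)[OF that] by (simp add: exp_add)
      then show ?thesis
        unfolding Q_def using g(1) h(1) by (intro exI[of _ "\<lambda>x. g x + h x"]) (auto intro: continuous_intros)
    qed
    show "\<exists>T. openin (top_of_set C) T \<and> a \<in> T \<and> (\<forall>b\<in>T. Q a b)" if a: "a \<in> C" for a
    proof -
      have "a \<in> - K" "open (- K)" using a C K by auto
      then obtain r where r: "r > 0" "ball a r \<subseteq> - K" using open_contains_ball by blast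
      have "Q a b" if b: "b \<in> ball a r" for b
      proof -
        have pos: "Re ((x - b) / (x - a)) > 0" "x \<noteq> a" if x: "x \<in> K" for x
        proof -
          have "\<not> dist a x < r" using r(2) x by auto
          then have far: "norm (b - a) < norm (x - a)"
            using b by (simp add: dist_norm norm_minus_commute)
          then show "x \<noteq> a" by auto
          have "(x - b) / (x - a) = 1 - (b - a) / (x - a)"
            using \<open>x \<noteq> a\<close> by (simp add: field_simps)
          moreover have "norm ((b - a) / (x - a)) < 1"
            using far by (simp add: norm_divide divide_less_eq)
          then have "Re ((b - a) / (x - a)) < 1" using complex_Re_le_cmod order_le_less_trans by blast
          ultimately show "Re ((x - b) / (x - a)) > 0" by simp
        qed
        then have nn: "(x - b) / (x - a) \<notin> \<real>\<^sub>\<le>\<^sub>0" if "x \<in> K" for x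
          using that by (metis complex_nonpos_Reals_iff not_less)
        let ?g = "\<lambda>x. Ln ((x - b) / (x - a))"
        have "continuous_on K ?g"
          using nn pos(2) by (intro continuous_intros) auto
        moreover have "x - b = (x - a) * exp (?g x)" if "x \<in> K" for x
        proof -
          have "(x - b) / (x - a) \<noteq> 0" using nn[OF that] by auto
          then show ?thesis using pos(2)[OF that] by simp
        qed
        ultimately show ?thesis unfolding Q_def by blast
      qed
      then show ?thesis using r(1) a by (intro exI[of _ "C \<inter> ball a r"]) auto
    qed
  qed
  then show ?thesis by (simp add: Q_def)
qed

text \<open>Two continuous logarithms of one function differ by a function with values in the
  discrete set of multiples of 2 \<pi> i.\<close>

lemma log_constant_on_connected:
  fixes h :: "complex \<Rightarrow> complex"
  assumes "connected A" "continuous_on A h" "\<And>x. x \<in> A \<Longrightarrow> exp (h x) = 1" "p \<in> A" "q \<in> A"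
  shows "h p = h q"
proof -
  have "h constant_on A"
  proof (rule continuous_discrete_range_constant[OF assms(1,2)])
    show "\<exists>e>0. \<forall>y. y \<in> A \<and> h y \<noteq> h x \<longrightarrow> e \<le> norm (h y - h x)" if x: "x \<in> A" for x
    proof (intro exI[of _ "2 * pi"] conjI allI impI)
      fix y assume y: "y \<in> A \<and> h y \<noteq> h x"
      obtain m n :: int where mn: "Re (h x) = 0" "Im (h x) = of_int (2 * m) * pi"
          "Re (h y) = 0" "Im (h y) = of_int (2 * n) * pi"
        using assms(3)[OF x] assms(3)[of y] y by (auto simp: exp_eq_1)
      then have "n \<noteq> m" using y by (auto simp: complex_eq_iff)
      then have "1 \<le> \<bar>real_of_int (n - m)\<bar>" by linarith
      then have "2 * pi \<le> 2 * pi * \<bar>real_of_int (n - m)\<bar>" by simp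
      also have "\<dots> = \<bar>Im (h y - h x)\<bar>"
      proof -
        have "Im (h y - h x) = 2 * pi * real_of_int (n - m)" using mn by (simp add: algebra_simps)
        then show ?thesis by (simp add: abs_mult)
      qed
      also have "\<dots> \<le> norm (h y - h x)" by (rule abs_Im_le_cmod)
      finally show "2 * pi \<le> norm (h y - h x)" .
    qed simp
  qed
  then show ?thesis using assms(4,5) by (auto simp: constant_on_def)
qed

text \<open>On each of the two arcs a branch of the logarithm of \<open>x - y\<close> is continuous; the branches
  differ by opposite multiples of \<open>i \<pi>\<close> at the two meeting points, which rules out a global
  continuous logarithm.\<close>

lemma arcs_separate:
  fixes A B C :: "complex set"
  assumes A: "closed A" "connected A" "\<And>x. x \<in> A \<Longrightarrow> Im x = Im y \<Longrightarrow> Re y < Re x"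
    and B: "closed B" "connected B" "\<And>x. x \<in> B \<Longrightarrow> Im x = Im y \<Longrightarrow> Re x < Re y"
    and top: "p \<in> A \<inter> B" "Im y < Im p" and bot: "q \<in> A \<inter> B" "Im q < Im y"
    and half: "\<And>x. x \<in> A \<union> B \<Longrightarrow> 0 < Re ((x - w) * d)"
    and C: "connected C" "C \<inter> (A \<union> B) = {}" "y \<in> C" "w \<in> C"
  shows False
proof -
  obtain g where g: "continuous_on (A \<union> B) g" "\<And>x. x \<in> A \<union> B \<Longrightarrow> x - y = (x - w) * exp (g x)"
    using continuous_log_quotient[OF closed_Un[OF A(1) B(1)] C(1,2,4,3)] by blast
  have d: "d \<noteq> 0" using half[of p] top by auto
  \<comment> \<open>A logarithm of x - y on both arcs at once: \<open>g\<close> is one of the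
    quotient (x - y) / (x - w), and the half-plane condition makes x - w accessible to
    \<open>Ln\<close> after rotation by \<open>d\<close>.\<close>
  define G where "G x = g x + Ln ((x - w) * d) - Ln d" for x
  have nn: "(x - w) * d \<notin> \<real>\<^sub>\<le>\<^sub>0" if "x \<in> A \<union> B" for x
    using half[OF that] by (metis complex_nonpos_Reals_iff not_less)
  have G: "continuous_on (A \<union> B) G"
    unfolding G_def using nn by (intro continuous_intros g(1)) auto
  have expG: "exp (G x) = x - y" if "x \<in> A \<union> B" for x
  proof -
    have "(x - w) * d \<noteq> 0" using nn[OF that] by auto
    then show ?thesis using g(2)[OF that] d by (simp add: G_def exp_add exp_diff)
  qed
  have nA: "x - y \<notin> \<real>\<^sub>\<le>\<^sub>0" if "x \<in> A" for x
    using A(3)[OF that] by (auto simp: complex_nonpos_Reals_iff)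
  have nB: "- (x - y) \<notin> \<real>\<^sub>\<le>\<^sub>0" if "x \<in> B" for x
    using B(3)[OF that] by (auto simp: complex_nonpos_Reals_iff)
  have ne: "p - y \<noteq> 0" "q - y \<noteq> 0" using top bot by auto
  have "G p - Ln (p - y) = G q - Ln (q - y)"
  proof (rule log_constant_on_connected[OF A(2), of "\<lambda>x. G x - Ln (x - y)"])
    show "continuous_on A (\<lambda>x. G x - Ln (x - y))"
      using nA by (intro continuous_intros continuous_on_subset[OF G]) auto
    show "exp (G x - Ln (x - y)) = 1" if "x \<in> A" for x
    proof -
      have "x - y \<noteq> 0" using nA[OF that] by auto
      then show ?thesis using expG[of x] that by (simp add: exp_diff)
    qed
  qed (use top bot in auto)
  moreover have "G p - Ln (- (p - y)) = G q - Ln (- (q - y))"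
  proof -
    \<comment> \<open>On \<open>B\<close> the cut of \<open>Ln\<close> is avoided by changing the
      sign of x - y; the constant \<open>Ln (-1)\<close> compensates, so that the exponential is
      1.\<close>
    have "G p - Ln (- (p - y)) - Ln (-1) = G q - Ln (- (q - y)) - Ln (-1)"
    proof (rule log_constant_on_connected[OF B(2), of "\<lambda>x. G x - Ln (- (x - y)) - Ln (-1)"])
      show "continuous_on B (\<lambda>x. G x - Ln (- (x - y)) - Ln (-1))"
        using nB by (intro continuous_intros continuous_on_subset[OF G]) auto
      show "exp (G x - Ln (- (x - y)) - Ln (-1)) = 1" if "x \<in> B" for x
      proof -
        define r where "r = x - y"
        have r: "- r \<noteq> 0" using nB[OF that] unfolding r_def by (metis nonpos_Reals_zero_I)
        have "exp (G x) = r" using expG[of x] that by (simp add: r_def)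
        moreover have "exp (Ln (- 1)) = (- 1 :: complex)" by (rule exp_Ln) simp
        ultimately have "exp (G x - Ln (- r) - Ln (-1)) = r / (- r) / (- 1)"
          by (simp only: exp_diff exp_Ln[OF r])
        then show ?thesis using r by (simp add: r_def del: minus_diff_eq)
      qed
    qed (use top bot in auto)
    then show ?thesis by simp
  qed
  moreover have "Ln (- (p - y)) = Ln (p - y) - \<i> * pi" "Ln (- (q - y)) = Ln (q - y) + \<i> * pi"
    using Ln_minus[OF ne(1)] Ln_minus[OF ne(2)] top(2) bot(2) by auto
  ultimately have "2 * (\<i> * complex_of_real pi) = 0" by algebra
  then show False by simp
qed

section \<open>The attractor\<close>

text \<open>Letter -1 gives the map f and letter 1 the map g of the iterated function
  system.\<close>

definition branch :: "complex \<Rightarrow> int \<Rightarrow> complex \<Rightarrow> complex" where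
  "branch z x y = z * y + (1 - z) * (1 + of_int x) / 2"

text \<open>The limit of the compositions of branches along \<open>e\<close>, that is (1 - z) times
  the sum of (1 + e_k)/2 * z^k, rewritten around the centre of symmetry 1/2.\<close>

definition address :: "complex \<Rightarrow> (nat \<Rightarrow> int) \<Rightarrow> complex" where
  "address z e = 1 / 2 + (1 - z) / 2 * series e z"

lemma branch_images:
  "(\<lambda>x. z * x) ` K \<union> (\<lambda>x. z * (x - 1) + 1) ` K = branch z (-1) ` K \<union> branch z 1 ` K"
proof -
  have 1: "(\<lambda>x. z * x) = branch z (-1)" and 2: "(\<lambda>x. z * (x - 1) + 1) = branch z 1"
    by (auto simp: branch_def fun_eq_iff algebra_simps diff_divide_distrib)
  show ?thesis unfolding 2 unfolding 1 ..
qed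

lemma norm_branch_diff: "norm (branch z x y - branch z x y') = norm z * norm (y - y')"
  by (simp add: branch_def flip: right_diff_distrib norm_mult)

lemma address_shift:
  assumes "e \<in> signs" "norm z < 1"
  shows "address z e = branch z (e 0) (address z (\<lambda>k. e (Suc k)))"
  by (simp add: address_def branch_def series_head[OF assms] field_simps)

lemma signs_Suc: "e \<in> signs \<Longrightarrow> (\<lambda>k. e (Suc k)) \<in> signs"
  by (simp add: signs_def)

lemma norm_address_le:
  assumes "e \<in> signs" "norm z < 1"
  shows "norm (address z e) \<le> 1 / 2 + norm ((1 - z) / 2) * (1 / (1 - norm z))"
  unfolding address_def
  using norm_series_le[OF assms(1) order.refl assms(2)]
  by (intro order_trans[OF norm_triangle_ineq] add_mono) (auto simp: norm_mult intro: mult_left_mono simp del: times_divide_eq_right)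

lemma closed_series_image:
  assumes z: "norm z < 1"
  shows "closed ((\<lambda>e. series e z) ` signs)"
proof -
  have "y \<in> (\<lambda>e. series e z) ` signs" if y: "y \<in> closure ((\<lambda>e. series e z) ` signs)" for y
  proof -
    define P where "P v \<longleftrightarrow> y \<in> closure ((\<lambda>e. series e z) ` cylinder v) \<and> sign_word v" for v
    have "\<exists>x. P (v @ [x])" if v: "P v" for v
    proof -
      have "y \<in> closure ((\<lambda>e. series e z) ` cylinder (v @ [1])) \<or>
          y \<in> closure ((\<lambda>e. series e z) ` cylinder (v @ [-1]))"
        using v cylinder_split[of v] by (simp add: P_def image_Un closure_Un)
      then show ?thesis using v sign_word_snoc unfolding P_def by blast
    qed
    moreover have "P []" using y by (simp add: P_def sign_word_def cylinder_def)
    ultimately obtain e where "\<And>n. P (map e [0..<length ([]::int list) + n])"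
      using koenig[of P "[]"] by blast
    then have e: "P (map e [0..<n])" for n by simp
    have es: "e \<in> signs" using prefixes_signs[of e 0] e unfolding P_def by simp
    have "norm (y - series e z) \<le> 2 * norm z ^ n / (1 - norm z)" for n
    proof (rule field_le_epsilon)
      fix \<epsilon> :: real assume "0 < \<epsilon>"
      then obtain e' where e': "e' \<in> cylinder (map e [0..<n])" "dist (series e' z) y < \<epsilon>"
        using e[of n] closure_approachable[of y] unfolding P_def by auto
      have "map e [0..<n] = map e' [0..<n]" using e'(1) by (simp add: cylinder_def)
      then have "norm (series e z - series e' z) \<le> 2 * norm z ^ n / (1 - norm z)"
        using z es cylinder_signs[OF e'(1)] by (intro series_close) auto
      moreover have "norm (y - series e z) \<le> norm (y - series e' z) + norm (series e z - series e' z)"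
        using norm_triangle_ineq4[of "y - series e' z" "series e z - series e' z"] by simp
      ultimately show "norm (y - series e z) \<le> 2 * norm z ^ n / (1 - norm z) + \<epsilon>"
        using e'(2) by (simp add: dist_norm norm_minus_commute)
    qed
    moreover have "(\<lambda>n. 2 * norm z ^ n / (1 - norm z)) \<longlonglongrightarrow> 2 * 0 / (1 - norm z)"
      using z by (intro tendsto_intros LIMSEQ_realpow_zero) auto
    ultimately have "norm (y - series e z) \<le> 0"
      by (intro LIMSEQ_le_const[where X = "\<lambda>n. 2 * norm z ^ n / (1 - norm z)"]) auto
    then show ?thesis using es by auto
  qed
  then show ?thesis using closure_subset_eq by blast
qed

lemma compact_addresses:
  assumes "norm z < 1"
  shows "compact (address z ` signs)"
proof -
  have "bounded ((\<lambda>e. series e z) ` signs)"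
    using norm_series_le[OF _ order.refl assms] by (auto simp: bounded_iff)
  then have "compact ((\<lambda>e. series e z) ` signs)"
    using closed_series_image[OF assms] by (simp add: compact_eq_bounded_closed)
  then have "compact ((\<lambda>s. 1 / 2 + (1 - z) / 2 * s) ` (\<lambda>e. series e z) ` signs)"
    by (rule compact_continuous_image[rotated]) (intro continuous_intros)
  then show ?thesis by (simp add: image_image address_def)
qed

lemma addresses_invariant:
  assumes z: "norm z < 1"
  shows "address z ` signs = branch z (-1) ` address z ` signs \<union> branch z 1 ` address z ` signs"
proof (intro equalityI subsetI)
  fix y assume "y \<in> address z ` signs"
  then obtain e where e: "e \<in> signs" "y = address z e" by blast
  then have "y = branch z (e 0) (address z (\<lambda>k. e (Suc k)))"
    using address_shift[OF e(1) z] by simp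
  then show "y \<in> branch z (-1) ` address z ` signs \<union> branch z 1 ` address z ` signs"
    using signs_values[OF e(1), of 0] signs_Suc[OF e(1)] by auto
next
  fix y assume "y \<in> branch z (-1) ` address z ` signs \<union> branch z 1 ` address z ` signs"
  then obtain x e where x: "x = 1 \<or> x = -1" "e \<in> signs" "y = branch z x (address z e)" by blast
  define e' where "e' = (\<lambda>k. case k of 0 \<Rightarrow> x | Suc k \<Rightarrow> e k)"
  have "e' \<in> signs" using x by (auto simp: signs_def e'_def split: nat.split)
  moreover have "y = address z e'"
    using address_shift[OF \<open>e' \<in> signs\<close> z] x(3) by (simp add: e'_def)
  ultimately show "y \<in> address z ` signs" by blast
qed

text \<open>Each branch scales distances by |z|. A point of \<open>K\<close> is pulled back for
  ever, and the letters used form its address; conversely, pushing points of \<open>K\<close>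
  forward along \<open>e\<close> comes within |z|^n (b + c) of the point with address
  \<open>e\<close>.\<close>

lemma invariant_compact_unique:
  assumes z: "norm z < 1" and K: "K \<noteq> {}" "compact K" "K = branch z (-1) ` K \<union> branch z 1 ` K"
  shows "K = address z ` signs"
proof -
  obtain b where b: "\<And>y. y \<in> K \<Longrightarrow> norm y \<le> b" using compact_imp_bounded[OF K(2)] by (auto simp: bounded_iff)
  obtain c where c: "\<And>e. e \<in> signs \<Longrightarrow> norm (address z e) \<le> c" using norm_address_le[OF _ z] by blast
  have bc: "norm (y - address z e) \<le> b + c" if "y \<in> K" "e \<in> signs" for y e
    using b[OF that(1)] c[OF that(2)] norm_triangle_ineq4[of y "address z e"] by linarith
  have lim: "(\<lambda>n. norm z ^ n * (b + c)) \<longlonglongrightarrow> 0"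
    using z by (intro tendsto_mult_left_zero LIMSEQ_realpow_zero) auto
  show ?thesis
  proof (intro equalityI subsetI)
    fix y assume y: "y \<in> K"
    have "\<exists>h. \<forall>n. (fst (h n) \<in> K \<and> (n = 0 \<longrightarrow> fst (h n) = y)) \<and>
        (fst (h n) = branch z (snd (h (Suc n))) (fst (h (Suc n))) \<and> snd (h (Suc n)) \<in> {1, -1})"
    proof (rule dependent_nat_choice)
      show "\<exists>h. fst h \<in> K \<and> (0 = 0 \<longrightarrow> fst h = y)" using y by auto
      show "\<exists>h'. (fst h' \<in> K \<and> (Suc n = 0 \<longrightarrow> fst h' = y)) \<and>
          (fst h = branch z (snd h') (fst h') \<and> snd h' \<in> {1, -1})"
        if "fst h \<in> K \<and> (n = 0 \<longrightarrow> fst h = y)" for h :: "complex \<times> int" and n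
      proof -
        have "fst h \<in> branch z (-1) ` K \<union> branch z 1 ` K" using that K(3) by blast
        then show ?thesis by fastforce
      qed
    qed
    then obtain h where h: "\<And>n. fst (h n) \<in> K" "fst (h 0) = y"
        "\<And>n. fst (h n) = branch z (snd (h (Suc n))) (fst (h (Suc n)))" "\<And>n. snd (h (Suc n)) \<in> {1, -1}"
      by blast
    \<comment> \<open>The letter leading from point \<open>n + 1\<close> back to point
      \<open>n\<close> is stored with point \<open>n + 1\<close>; \<open>snd (h 0)\<close> carries
      no information.\<close>
    define e where "e n = snd (h (Suc n))" for n
    have sh: "(\<lambda>k. e (k + n)) \<in> signs" for n using h(4) by (auto simp: signs_def e_def)
    have "norm (y - address z e) \<le> norm z ^ n * (b + c)" for n
    proof -
      have "norm (fst (h m) - address z (\<lambda>k. e (k + m))) \<le> norm z ^ n * (b + c)" for m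
      proof (induction n arbitrary: m)
        case 0
        then show ?case using bc[OF h(1) sh] by simp
      next
        case (Suc n)
        have "address z (\<lambda>k. e (k + m)) = branch z (e m) (address z (\<lambda>k. e (k + Suc m)))"
          using address_shift[OF sh z, of m] by simp
        then have "norm (fst (h m) - address z (\<lambda>k. e (k + m)))
            = norm z * norm (fst (h (Suc m)) - address z (\<lambda>k. e (k + Suc m)))"
          using h(3)[of m] by (simp add: e_def[symmetric] norm_branch_diff)
        also have "\<dots> \<le> norm z * (norm z ^ n * (b + c))" by (intro mult_left_mono Suc) auto
        finally show ?case by (simp add: mult_ac)
      qed
      from this[of 0] show ?thesis using h(2) by simp
    qed
    then have "norm (y - address z e) \<le> 0" using lim by (intro LIMSEQ_le_const) auto
    then show "y \<in> address z ` signs" using sh[of 0] by auto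
  next
    fix y assume "y \<in> address z ` signs"
    then obtain e where e: "e \<in> signs" "y = address z e" by blast
    have approx: "\<exists>y\<in>K. norm (y - address z e) \<le> norm z ^ n * (b + c)" if "e \<in> signs" for n e
      using that
    proof (induction n arbitrary: e)
      case 0
      then show ?case using K(1) bc by fastforce
    next
      case (Suc n)
      obtain y' where y': "y' \<in> K" "norm (y' - address z (\<lambda>k. e (Suc k))) \<le> norm z ^ n * (b + c)"
        using Suc.IH[OF signs_Suc[OF Suc.prems]] by blast
      have "branch z (e 0) y' \<in> K"
        using y'(1) K(3) signs_values[OF Suc.prems, of 0] by auto
      moreover have "norm (branch z (e 0) y' - address z e) \<le> norm z ^ Suc n * (b + c)"
        using y'(2) by (simp add: address_shift[OF Suc.prems z] norm_branch_diff mult.assoc mult_left_mono)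
      ultimately show ?case by blast
    qed
    have "y \<in> closure K"
      unfolding closure_approachable
    proof (intro allI impI)
      fix \<epsilon> :: real assume "0 < \<epsilon>"
      then obtain n where "norm z ^ n * (b + c) < \<epsilon>"
        using order_tendstoD(2)[OF lim] by (auto simp: eventually_sequentially)
      then show "\<exists>x\<in>K. dist x y < \<epsilon>"
        using approx[OF e(1), of n] e(2) by (force simp: dist_norm)
    qed
    then show "y \<in> K" using compact_imp_closed[OF K(2)] by simp
  qed
qed

lemma attractor_eq_addresses:
  assumes "norm z < 1"
  shows "attractor z = address z ` signs"
  unfolding attractor_def branch_images
proof (rule the_equality)
  have "(\<lambda>_. 1) \<in> signs" by (simp add: signs_def)
  then show "address z ` signs \<noteq> {} \<and> compact (address z ` signs) \<and>
      address z ` signs = branch z (-1) ` address z ` signs \<union> branch z 1 ` address z ` signs"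
    using compact_addresses[OF assms] addresses_invariant[OF assms] by blast
  show "K = address z ` signs"
    if "K \<noteq> {} \<and> compact K \<and> K = branch z (-1) ` K \<union> branch z 1 ` K" for K
    using invariant_compact_unique[OF assms] that by blast
qed

theorem M0_iff: "z \<in> M0 \<longleftrightarrow> z \<in> punctured_disc \<and> (\<exists>e\<in>signs. series e z = 0)"
proof (cases "z \<in> punctured_disc")
  case True
  then have z: "norm z < 1" "z \<noteq> 1" by (auto simp: punctured_disc_def)
  show ?thesis
    unfolding M0_def attractor_eq_addresses[OF z(1)]
    using True z(2) by (auto simp: M0_def attractor_eq_addresses[OF z(1)] address_def)
qed (simp add: M0_def)

section \<open>Certified pieces\<close>

text \<open>A common bound for |z| on all discs of the loop; it is 6920 in the unit 1 / 10^4 of the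
  coordinates below.\<close>

abbreviation rho :: real where "rho \<equiv> 173 / 250"

definition node :: "int \<Rightarrow> int \<Rightarrow> complex" where
  "node x y = Complex (of_int x / 10 ^ 4) (of_int y / 10 ^ 4)"

definition disc :: "int \<Rightarrow> int \<Rightarrow> int \<Rightarrow> complex set" where
  "disc x y r = cball (node x y) (of_int r / 10 ^ 4)"

lemma norm_node_le:
  assumes "x\<^sup>2 + y\<^sup>2 \<le> c\<^sup>2" "0 \<le> c"
  shows "norm (node x y) \<le> of_int c / 10 ^ 4"
proof -
  have "(norm (node x y))\<^sup>2 = of_int (x\<^sup>2 + y\<^sup>2) / (10 ^ 4)\<^sup>2"
    by (simp add: node_def cmod_power2 power_divide add_divide_distrib)
  also have "\<dots> \<le> of_int (c\<^sup>2) / (10 ^ 4)\<^sup>2"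
    using assms(1) by (intro divide_right_mono) (simp_all only: of_int_le_iff, simp)
  also have "\<dots> = (of_int c / 10 ^ 4)\<^sup>2" by (simp add: power_divide)
  finally have "(norm (node x y))\<^sup>2 \<le> (of_int c / 10 ^ 4)\<^sup>2" .
  then show ?thesis by (rule power2_le_imp_le) (use assms(2) in simp)
qed

lemma node_diff: "node x y - node a b = node (x - a) (y - b)"
  by (simp add: node_def complex_eq_iff diff_divide_distrib)

lemma disc_subset_disc:
  assumes "(a - x)\<^sup>2 + (b - y)\<^sup>2 \<le> (r - s)\<^sup>2" "s \<le> r"
  shows "disc a b s \<subseteq> disc x y r"
proof -
  have "dist (node a b) (node x y) \<le> of_int (r - s) / 10 ^ 4"
    unfolding dist_norm node_diff using assms by (intro norm_node_le) auto
  then show ?thesis unfolding disc_def by (simp add: cball_subset_cball_iff diff_divide_distrib)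
qed

lemma disc_subset_cball:
  assumes "x\<^sup>2 + y\<^sup>2 \<le> (6920 - r)\<^sup>2" "r \<le> 6920"
  shows "norm (node x y) + of_int r / 10 ^ 4 \<le> rho" "disc x y r \<subseteq> cball 0 rho"
proof -
  have "norm (node x y) \<le> of_int (6920 - r) / 10 ^ 4"
    using assms by (intro norm_node_le) auto
  then show *: "norm (node x y) + of_int r / 10 ^ 4 \<le> rho" by (simp add: field_simps)
  show "disc x y r \<subseteq> cball 0 rho"
  proof
    fix z assume "z \<in> disc x y r"
    then have "norm (z - node x y) \<le> of_int r / 10 ^ 4"
      by (simp add: disc_def dist_norm norm_minus_commute)
    then show "z \<in> cball 0 rho" using * norm_triangle_sub[of z "node x y"] by simp
  qed
qed

text \<open>Value and derivative of a word at \<open>node x y\<close>, scaled by the common denominator that is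
  returned in the first component.\<close>

fun ihorner_step ::
  "int \<Rightarrow> int \<Rightarrow> int \<Rightarrow> int \<times> int \<times> int \<times> int \<times> int \<Rightarrow> int \<times> int \<times> int \<times> int \<times> int" where
  "ihorner_step x y c (s, p, q, u, v) =
    (10000 * s, c * 10000 * s + x * p - y * q, x * q + y * p,
     10000 * p + x * u - y * v, 10000 * q + x * v + y * u)"

primrec ihorner :: "int \<Rightarrow> int \<Rightarrow> int list \<Rightarrow> int \<times> int \<times> int \<times> int \<times> int" where
  "ihorner x y [] = (1, 0, 0, 0, 0)"
| "ihorner x y (c # cs) = ihorner_step x y c (ihorner x y cs)"

lemma ihorner_correct:
  "ihorner x y xs = (s, p, q, u, v) \<Longrightarrow> 0 < s \<and>
    of_int s * horner xs (node x y) = Complex (of_int p) (of_int q) \<and>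
    of_int s * dhorner xs (node x y) = Complex (of_int u) (of_int v)"
proof (induction xs arbitrary: s p q u v)
  case Nil
  then show ?case by (auto simp: complex_eq_iff)
next
  case (Cons c cs)
  obtain s' p' q' u' v' where i: "ihorner x y cs = (s', p', q', u', v')" by (metis prod_cases5)
  note IH = Cons.IH[OF i]
  have a: "10000 * node x y = Complex (of_int x) (of_int y)" by (simp add: node_def complex_eq_iff)
  have e: "s = 10000 * s'" "p = c * 10000 * s' + x * p' - y * q'" "q = x * q' + y * p'"
    "u = 10000 * p' + x * u' - y * v'" "v = 10000 * q' + x * v' + y * u'"
    using Cons.prems i by auto
  have "of_int s * horner (c # cs) (node x y)
      = of_int (c * 10000 * s') + (10000 * node x y) * (of_int s' * horner cs (node x y))"
    by (simp add: e algebra_simps)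
  also have "\<dots> = Complex (of_int p) (of_int q)"
    using IH unfolding a by (simp add: e complex_eq_iff)
  finally have 1: "of_int s * horner (c # cs) (node x y) = Complex (of_int p) (of_int q)" .
  have "of_int s * dhorner (c # cs) (node x y)
      = 10000 * (of_int s' * horner cs (node x y)) + (10000 * node x y) * (of_int s' * dhorner cs (node x y))"
    by (simp add: e algebra_simps)
  also have "\<dots> = Complex (of_int u) (of_int v)"
    using IH unfolding a by (simp add: e complex_eq_iff)
  finally have "of_int s * dhorner (c # cs) (node x y) = Complex (of_int u) (of_int v)" .
  with 1 show ?case using IH e by auto
qed

text \<open>The derivatives of all words below point roughly in the direction \<open>(- 9 + 40 i) / 41\<close>, so that a
  linear test suffices.\<close>

fun near_zero_test :: "int \<Rightarrow> int \<Rightarrow> int \<times> int \<times> int \<times> int \<times> int \<Rightarrow> bool" where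
  "near_zero_test d k (s, p, q, u, v) \<longleftrightarrow>
     10 ^ 6 * (\<bar>p\<bar> + \<bar>q\<bar>) \<le> d * s \<and> 41 * k * s \<le> 100 * (40 * v - 9 * u)"

definition near_zero :: "int list \<Rightarrow> int \<Rightarrow> int \<Rightarrow> int \<Rightarrow> int \<Rightarrow> bool" where
  "near_zero xs x y d k \<longleftrightarrow> near_zero_test d k (ihorner x y xs)"

lemma near_zeroD:
  assumes "near_zero xs x y d k"
  shows "norm (horner xs (node x y)) \<le> of_int d / 10 ^ 6" "of_int k / 100 \<le> norm (dhorner xs (node x y))"
proof -
  obtain s p q u v where i: "ihorner x y xs = (s, p, q, u, v)" by (metis prod_cases5)
  have c: "0 < s" "of_int s * horner xs (node x y) = Complex (of_int p) (of_int q)"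
      "of_int s * dhorner xs (node x y) = Complex (of_int u) (of_int v)"
    using ihorner_correct[OF i] by auto
  have d: "10 ^ 6 * (\<bar>p\<bar> + \<bar>q\<bar>) \<le> d * s" "41 * k * s \<le> 100 * (40 * v - 9 * u)"
    using assms i by (auto simp: near_zero_def)
  have n1: "of_int s * norm (horner xs (node x y)) = cmod (Complex (of_int p) (of_int q))"
    using arg_cong[OF c(2), of norm] c(1) by (simp add: norm_mult)
  have n2: "of_int s * norm (dhorner xs (node x y)) = cmod (Complex (of_int u) (of_int v))"
    using arg_cong[OF c(3), of norm] c(1) by (simp add: norm_mult)
  have "10 ^ 6 * (of_int s * norm (horner xs (node x y))) \<le> 10 ^ 6 * (\<bar>of_int p\<bar> + \<bar>of_int q\<bar>)"
    unfolding n1 using cmod_le[of "Complex (of_int p) (of_int q)"] by simp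
  also have "\<dots> = of_int (10 ^ 6 * (\<bar>p\<bar> + \<bar>q\<bar>))" by simp
  also have "\<dots> \<le> of_int (d * s)" using d(1) by (simp only: of_int_le_iff)
  finally have "of_int s * (10 ^ 6 * norm (horner xs (node x y))) \<le> of_int s * of_int d"
    by (simp add: algebra_simps)
  then show "norm (horner xs (node x y)) \<le> of_int d / 10 ^ 6" using c(1) by simp
  have "of_int (41 * k * s) \<le> (of_int (100 * (40 * v - 9 * u)) :: real)"
    using d(2) by (simp only: of_int_le_iff)
  \<comment> \<open>The second factor is the conjugate of - 9 + 40 i and has modulus 41.\<close>
  also have "\<dots> = 100 * Re (Complex (of_int u) (of_int v) * Complex (- 9) (- 40))" by simp
  also have "\<dots> \<le> 100 * (cmod (Complex (of_int u) (of_int v)) * cmod (Complex (- 9) (- 40)))"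
    unfolding norm_mult[symmetric] by (intro mult_left_mono complex_Re_le_cmod) simp
  also have "cmod (Complex (- 9) (- 40)) = 41"
    unfolding complex_norm by (rule real_sqrt_unique) simp_all
  finally have "of_int s * of_int k \<le> of_int s * (100 * norm (dhorner xs (node x y)))"
    unfolding n2[symmetric] by (simp add: algebra_simps)
  then show "of_int k / 100 \<le> norm (dhorner xs (node x y))" using c(1) by simp
qed

text \<open>A piece \<open>(u, x, y, r, k)\<close> stands for the zeros of the series with prefix \<open>u\<close> in the disc of
  centre \<open>(x + i y) / 10\<^sup>4\<close> and radius \<open>r / 10\<^sup>4\<close>, where the derivative at the centre is at least \<open>k / 100\<close>.\<close>

type_synonym piece = "int list \<times> int \<times> int \<times> int \<times> int"

definition region :: "piece \<Rightarrow> complex set" where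
  "region = (\<lambda>(u, x, y, r, k). zeros u (disc x y r))"

text \<open>Upper bounds, in units of \<open>10\<^sup>-\<^sup>6\<close>, for the size and the Lipschitz constant on \<open>cball 0 rho\<close>
  of the tail of a series from the term of index \<open>m\<close> on.\<close>

definition tail_bounds :: "nat \<Rightarrow> int \<times> int" where
  "tail_bounds m = (if m = 15 then (12974, 323327) else if m = 16 then (8978, 236716) else (6213, 172785))"

text \<open>The two inequalities of \<open>isolates_cball\<close> cleared of denominators: L <
  \<kappa> and the Newton condition. The slope 6850 is 200 / (1 - rho)^3 rounded up, and 310 bounds
  the value of the word at the centre in units of 1 / 10^6.\<close>

fun radius_test :: "int \<Rightarrow> int \<Rightarrow> int \<times> int \<Rightarrow> bool" where
  "radius_test r k (t, l) \<longleftrightarrow>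
     6850 * r + l < 10 ^ 4 * k \<and> (310 + t) * 10 ^ 4 \<le> (10 ^ 4 * k - 6850 * r - l) * r"

fun valid_piece :: "piece \<Rightarrow> bool" where
  "valid_piece (u, x, y, r, k) \<longleftrightarrow> length u \<in> {15, 16, 17} \<and> set u \<subseteq> {1, -1} \<and> 0 \<le> r \<and> r \<le> 6920 \<and>
     x\<^sup>2 + y\<^sup>2 \<le> (6920 - r)\<^sup>2 \<and> near_zero u x y 310 k \<and> radius_test r k (tail_bounds (length u))"

lemma tail_bounds_correct:
  assumes "m \<in> {15, 16, 17}" "tail_bounds m = (t, l)"
  shows "rho ^ m / (1 - rho) \<le> of_int t / 10 ^ 6"
    "real m * rho ^ (m - 1) / (1 - rho) + rho ^ m / (1 - rho)\<^sup>2 \<le> of_int l / 10 ^ 6"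
  using assms by (auto simp: tail_bounds_def power_divide)

lemma valid_piece_properties:
  assumes "valid_piece P"
  shows "closed (region P)" "connected (region P)" "region P \<subseteq> M0"
proof -
  obtain u x y r k where P: "P = (u, x, y, r, k)" by (metis prod_cases5)
  obtain t l where tl: "tail_bounds (length u) = (t, l)" by (metis surj_pair)
  have v: "length u \<in> {15, 16, 17}" "sign_word u" "0 \<le> r" "r \<le> 6920" "x\<^sup>2 + y\<^sup>2 \<le> (6920 - r)\<^sup>2"
      "near_zero u x y 310 k" "6850 * r + l < 10 ^ 4 * k" "(310 + t) * 10 ^ 4 \<le> (10 ^ 4 * k - 6850 * r - l) * r"
    using assms tl by (auto simp: P sign_word_def)
  note sub = disc_subset_cball[OF v(5,4)]
  let ?R = "real_of_int r / 10 ^ 4" and ?L = "(6850 * real_of_int r + of_int l) / 10 ^ 6"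
  have "isolates u (disc x y r)"
    unfolding disc_def
  proof (rule isolates_cball[where \<rho> = rho and \<kappa> = "of_int k / 100" and \<delta> = "of_int 310 / 10 ^ 6" and L = ?L])
    have "2 * ?R / (1 - rho) ^ 3 \<le> 6850 * real_of_int r / 10 ^ 6"
      using v(3) by (simp add: power_divide)
    then show "2 * ?R / (1 - rho) ^ 3 + real (length u) * rho ^ (length u - 1) / (1 - rho)
        + rho ^ length u / (1 - rho)\<^sup>2 \<le> ?L"
      using tail_bounds_correct(2)[OF v(1) tl] unfolding add_divide_distrib by linarith
    have "real_of_int (6850 * r + l) < real_of_int (10 ^ 4 * k)" using v(7) by (simp only: of_int_less_iff)
    then show "?L < of_int k / 100" by simp
    have "real_of_int ((310 + t) * 10 ^ 4) \<le> real_of_int ((10 ^ 4 * k - 6850 * r - l) * r)"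
      using v(8) by (simp only: of_int_le_iff)
    then have "of_int 310 / 10 ^ 6 + of_int t / 10 ^ 6 \<le> (of_int k / 100 - ?L) * ?R"
      by (simp add: field_simps)
    then show "of_int 310 / 10 ^ 6 + rho ^ length u / (1 - rho) \<le> (of_int k / 100 - ?L) * ?R"
      using tail_bounds_correct(1)[OF v(1) tl] by linarith
  qed (use v sub near_zeroD[OF v(6)] in auto)
  moreover have "u \<noteq> []" using v(1) by auto
  ultimately show "connected (region P)"
    using connected_zeros[OF sub(2) _ v(2)] by (simp add: P region_def)
  show "closed (region P)"
    unfolding P region_def using v(2) sub(2) by (auto intro!: closed_zeros[of _ rho] simp: disc_def)
  show "region P \<subseteq> M0"
  proof
    fix z assume "z \<in> region P"
    then obtain e where e: "z \<in> disc x y r" "e \<in> signs" "series e z = 0"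
      by (auto simp: P region_def zeros_def cylinder_def)
    then have n: "norm z < 1" using sub(2) by auto
    moreover have "z \<noteq> 0"
    proof
      assume "z = 0"
      then have "e 0 = 0" using e(2,3) series_head[of e 0] by simp
      then show False using signs_abs[OF e(2), of 0] by simp
    qed
    ultimately show "z \<in> M0" using e by (auto simp: M0_iff punctured_disc_def)
  qed
qed

text \<open>Signed copies of the first \<open>m\<close> letters, each signed by the letter of
  \<open>u\<close> at which it starts. As \<open>u\<close> starts with 1, this restores
  \<open>u\<close> if every block of \<open>u\<close> is plus or minus the first one. The number of
  copies is the quotient of the lengths rounded up, so the result may overshoot
  \<open>u\<close>.\<close>

definition blocks :: "nat \<Rightarrow> int list \<Rightarrow> int list" where
  "blocks m u = concat (map (\<lambda>i. map ((*) (u ! (i * m))) (take m u)) [0..<(length u + m - 1) div m])"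

lemma horner_mult: "horner (map ((*) c) xs) z = of_int c * horner xs z"
  by (induction xs) (auto simp: algebra_simps)

lemma horner_blocks: "horner (take m u) z = 0 \<Longrightarrow> horner (blocks m u) z = 0"
proof -
  assume h: "horner (take m u) z = 0"
  have "horner (concat (map (\<lambda>i. map ((*) (u ! (i * m))) (take m u)) is)) z = 0" for "is"
    by (induction "is") (auto simp: horner_append horner_mult h)
  then show ?thesis by (simp add: blocks_def)
qed

text \<open>An approximate zero becomes an exact one in the disc of radius 2 / 10^4: the Newton
  bound (3 - 2 R / (1 - rho)^3) R with R = 2 / 10^4 exceeds 590 / 10^6. The bound 6918 leaves room
  for this radius below 6920.\<close>

lemma near_zero_exact:
  assumes "near_zero v x y 590 300" "\<forall>c\<in>set v. \<bar>c\<bar> \<le> 1" "x\<^sup>2 + y\<^sup>2 \<le> 6918\<^sup>2"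
  shows "\<exists>z \<in> disc x y 2. horner v z = 0 \<and> norm z < 1"
proof -
  have "norm (node x y) \<le> of_int 6918 / 10 ^ 4" using assms(3) by (intro norm_node_le) auto
  then have n: "norm (node x y) + of_int 2 / 10 ^ 4 \<le> rho" by simp
  have "\<exists>z \<in> cball (node x y) (of_int 2 / 10 ^ 4). horner v z = 0"
  proof (rule horner_zero_near[where \<rho> = rho and \<kappa> = 3])
    show "norm (horner v (node x y)) \<le> (3 - 2 * (of_int 2 / 10 ^ 4) / (1 - rho) ^ 3) * (of_int 2 / 10 ^ 4)"
      using near_zeroD(1)[OF assms(1)] by (simp add: power_divide)
    show "3 \<le> norm (dhorner v (node x y))" using near_zeroD(2)[OF assms(1)] by simp
  qed (use n assms(2) in \<open>auto simp: small_word_def power_divide\<close>)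
  then obtain z where z: "z \<in> disc x y 2" "horner v z = 0" by (auto simp: disc_def)
  moreover have "disc x y 2 \<subseteq> cball 0 rho" using assms(3) by (intro disc_subset_cball) auto
  ultimately show ?thesis by force
qed

text \<open>The certificate gives the length \<open>m\<close> of a common prefix and an approximate
  zero (a, b) of it. Both words continue that prefix by signed copies of itself, so the exact zero,
  which lies in both discs, belongs to both pieces.\<close>

fun link :: "piece \<Rightarrow> piece \<Rightarrow> nat \<times> int \<times> int \<Rightarrow> bool" where
  "link (u, x, y, r, k) (u', x', y', r', k') (m, a, b) \<longleftrightarrow>
     take m u = take m u' \<and> near_zero (take m u) a b 590 300 \<and> a\<^sup>2 + b\<^sup>2 \<le> 6918\<^sup>2 \<and>
     2 \<le> r \<and> (a - x)\<^sup>2 + (b - y)\<^sup>2 \<le> (r - 2)\<^sup>2 \<and> 2 \<le> r' \<and> (a - x')\<^sup>2 + (b - y')\<^sup>2 \<le> (r' - 2)\<^sup>2 \<and>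
     u \<noteq> [] \<and> u' \<noteq> [] \<and> set (blocks m u) \<subseteq> {1, -1} \<and> set (blocks m u') \<subseteq> {1, -1} \<and> set (take m u) \<subseteq> {1, -1} \<and>
     take (length u) (blocks m u) = u \<and> take (length u') (blocks m u') = u'"

lemma link_meets:
  assumes "link P Q (m, a, b)"
  shows "region P \<inter> region Q \<inter> disc a b 2 \<noteq> {}"
proof -
  obtain u x y r k where P: "P = (u, x, y, r, k)" by (metis prod_cases5)
  obtain u' x' y' r' k' where Q: "Q = (u', x', y', r', k')" by (metis prod_cases5)
  have l: "take m u = take m u'" "near_zero (take m u) a b 590 300" "a\<^sup>2 + b\<^sup>2 \<le> 6918\<^sup>2"
      "2 \<le> r" "(a - x)\<^sup>2 + (b - y)\<^sup>2 \<le> (r - 2)\<^sup>2" "2 \<le> r'" "(a - x')\<^sup>2 + (b - y')\<^sup>2 \<le> (r' - 2)\<^sup>2"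
      "u \<noteq> []" "u' \<noteq> []" "sign_word (blocks m u)" "sign_word (blocks m u')" "set (take m u) \<subseteq> {1, -1}"
      "take (length u) (blocks m u) = u" "take (length u') (blocks m u') = u'"
    using assms unfolding P Q link.simps sign_word_def by auto
  obtain z where z: "z \<in> disc a b 2" "horner (take m u) z = 0" "norm z < 1"
    using near_zero_exact[OF l(2) _ l(3)] l(12) by fastforce
  have "z \<in> zeros u (disc x y r)"
    using z l disc_subset_disc[OF l(5,4)] by (intro horner_zero_in_zeros[of "blocks m u"] horner_blocks) auto
  moreover have "z \<in> zeros u' (disc x' y' r')"
    using z l disc_subset_disc[OF l(7,6)] by (intro horner_zero_in_zeros[of "blocks m u'"] horner_blocks) auto
  ultimately show ?thesis using z(1) by (auto simp: P Q region_def)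
qed

fun linked :: "piece list \<Rightarrow> (nat \<times> int \<times> int) list \<Rightarrow> bool" where
  "linked (P # Ps) [] \<longleftrightarrow> Ps = [] \<and> valid_piece P"
| "linked (P # Ps) (J # Js) \<longleftrightarrow> Ps \<noteq> [] \<and> valid_piece P \<and> link P (hd Ps) J \<and> linked Ps Js"
| "linked [] Js \<longleftrightarrow> False"

definition support :: "piece list \<Rightarrow> complex set" where
  "support Ps = (\<Union>P\<in>set Ps. region P)"

lemma linked_properties:
  "linked Ps Js \<Longrightarrow> closed (support Ps) \<and> connected (support Ps) \<and> support Ps \<subseteq> M0"
proof (induction Js arbitrary: Ps)
  case Nil
  then obtain P where "Ps = [P]" "valid_piece P" by (cases Ps) auto
  then show ?case using valid_piece_properties by (auto simp: support_def)
next
  case (Cons J Js)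
  then obtain P Q Ps' where Ps: "Ps = P # Q # Ps'" "valid_piece P" "link P Q J" "linked (Q # Ps') Js"
    by (cases Ps; cases "tl Ps") auto
  have P: "closed (region P)" "connected (region P)" "region P \<subseteq> M0"
    using valid_piece_properties[OF Ps(2)] by auto
  have Q: "closed (support (Q # Ps'))" "connected (support (Q # Ps'))" "support (Q # Ps') \<subseteq> M0"
    using Cons.IH[OF Ps(4)] by auto
  have U: "support Ps = region P \<union> support (Q # Ps')" by (simp add: support_def Ps)
  obtain m a b where J: "J = (m, a, b)" by (metis prod_cases3)
  have "region P \<inter> region Q \<noteq> {}" using link_meets[of P Q m a b] Ps(3) J by auto
  moreover have "region Q \<subseteq> support (Q # Ps')" by (auto simp: support_def)
  ultimately have "region P \<inter> support (Q # Ps') \<noteq> {}" by blast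
  then show ?case unfolding U using P Q by (auto intro: connected_Un)
qed

section \<open>The loop\<close>

text \<open>The pieces run counterclockwise: up the right side here, then down the left side in
  \<open>left_arc\<close>.\<close>

definition right_arc :: "piece list" where
  "right_arc =
    [([1,-1,1,1,1,-1,-1,1,-1,-1,-1,1,-1,1,-1,-1], 3963, 5467, 34, 324),
     ([1,-1,1,1,1,-1,1,-1,1,1,1,-1,1,-1,1], 3979, 5465, 43, 376),
     ([1,-1,1,1,1,-1,1,-1,1,1,1,-1,1,1,-1,1], 3998, 5474, 29, 366),
     ([1,-1,1,1,1,-1,1,-1,1,1,1,-1,1,1,1,-1,1], 4001, 5489, 20, 358),
     ([1,-1,1,1,1,-1,1,-1,1,1,-1,1,-1,-1,-1,1,-1], 4009, 5495, 20, 366),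
     ([1,-1,1,1,1,-1,1,-1,1,1,-1,1,-1,-1,1,-1], 4012, 5510, 30, 358),
     ([1,-1,1,1,1,-1,1,-1,1,1,-1,1,-1,1,-1,1], 4025, 5523, 31, 349),
     ([1,-1,1,1,1,-1,1,-1,1,1,-1,1,-1,1,1], 4023, 5547, 49, 339),
     ([1,-1,1,1,1,-1,1,-1,1,1,-1,-1,1,-1,-1], 4015, 5558, 48, 343),
     ([1,-1,1,1,1,-1,1,-1,1,1,-1,-1,1,-1,1], 4000, 5584, 50, 336),
     ([1,-1,1,1,1,-1,1,-1,1,1,-1,-1,-1,1,-1], 3971, 5583, 48, 345)]"

definition left_arc :: "piece list" where
  "left_arc =
    [([1,-1,1,1,1,-1,1,-1,1,1,-1,-1,-1,-1,1,-1], 3951, 5567, 30, 358),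
     ([1,-1,1,1,1,-1,-1,1,-1,-1,-1,-1,1,1,-1,1], 3947, 5544, 38, 300),
     ([1,-1,1,1,1,-1,-1,1,-1,-1,-1,-1,1,-1,1,-1], 3935, 5528, 36, 310),
     ([1,-1,1,1,1,-1,-1,1,-1,-1,-1,-1,1,-1,-1,1,-1], 3934, 5511, 23, 319),
     ([1,-1,1,1,1,-1,-1,1,-1,-1,-1,-1,1,-1,-1,-1,1], 3943, 5499, 23, 321),
     ([1,-1,1,1,1,-1,-1,1,-1,-1,-1,1,-1,1,1,1,-1], 3941, 5499, 23, 317),
     ([1,-1,1,1,1,-1,-1,1,-1,-1,-1,1,-1,1,1,-1,1], 3950, 5488, 23, 320),
     ([1,-1,1,1,1,-1,-1,1,-1,-1,-1,1,-1,1,-1,1,-1], 3952, 5476, 23, 324)]"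

lemma right_arc_linked: "linked right_arc [(6, 3968, 5467), (13, 3992, 5468), (14, 4002, 5483), (10, 4005, 5492), (14, 4008, 5500), (13, 4018, 5517), (14, 4029, 5534), (11, 4019, 5552), (14, 4008, 5571), (12, 3985, 5584)]"
  by code_simp

text \<open>The head is set apart because its contact with the second piece is not at a zero of
  their common prefix.\<close>

lemma left_arc_linked: "linked (tl left_arc) [(13, 3941, 5536), (14, 3932, 5517), (15, 3938, 5505), (11, 3942, 5499), (15, 3946, 5493), (14, 3951, 5482)]"
  by code_simp

lemma left_arc_start_valid: "valid_piece (hd left_arc)"
  by code_simp

lemma arcs_linked:
  "link (last right_arc) (hd left_arc) (13, 3956, 5575)" "link (last left_arc) (hd right_arc) (15, 3955, 5470)"
  by code_simp+

text \<open>The loop closes up because \<open>g = 1 - z + z\<^sup>2 + z\<^sup>3 - z\<^sup>6 - z\<^sup>7\<close> has two different multiples with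
  coefficients \<open>\<plusminus>1\<close>, namely \<open>g (1 + z\<^sup>4 \<plusminus> z\<^sup>6)\<close>.\<close>

lemma left_arc_closing:
  "region (hd left_arc) \<inter> region (hd (tl left_arc)) \<noteq> {}"
proof -
  let ?g = "[1, -1, 1, 1, 0, 0, -1, -1] :: int list"
  let ?p = "[1, -1, 1, 1, 1, -1, 1, -1, 1, 1, -1, -1, -1, -1] :: int list"
  let ?q = "[1, -1, 1, 1, 1, -1, -1, 1, -1, -1, -1, -1, 1, 1] :: int list"
  have "near_zero ?g 3950 5556 590 300" by code_simp
  then obtain z where z: "z \<in> disc 3950 5556 2" "horner ?g z = 0" "norm z < 1"
    using near_zero_exact[of ?g 3950 5556] by auto
  have "horner ?p z = horner ?g z * (1 + z ^ 4 + z ^ 6)" "horner ?q z = horner ?g z * (1 + z ^ 4 - z ^ 6)"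
    by (simp_all, algebra+)
  then have pq: "horner ?p z = 0" "horner ?q z = 0" using z(2) by simp_all
  have sub: "disc 3950 5556 2 \<subseteq> disc 3951 5567 30" "disc 3950 5556 2 \<subseteq> disc 3947 5544 38"
    by (rule disc_subset_disc; simp)+
  have "z \<in> region (hd left_arc)"
    unfolding left_arc_def region_def list.sel prod.case
    \<comment> \<open>The piece has a word of 16 letters: \<open>?p\<close> and the first two
      letters of its repetition. The other word continues \<open>?q\<close> with the opposite
      signs.\<close>
    by (rule horner_zero_in_zeros[of "?p @ ?p"])
      (use z sub pq in \<open>simp_all only: horner_append, auto simp: sign_word_def\<close>)
  moreover have "z \<in> region (hd (tl left_arc))"
    unfolding left_arc_def region_def list.sel prod.case
    by (rule horner_zero_in_zeros[of "?q @ map uminus ?q"])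
      (use z sub pq in \<open>simp_all only: horner_append horner_uminus, auto simp: sign_word_def\<close>)
  ultimately show ?thesis by blast
qed

definition hole_point :: complex where
  "hole_point = node 3970 5510"

text \<open>\<open>placed \<sigma> P\<close> says that the disc of \<open>P\<close> misses the horizontal ray from \<open>hole_point\<close> in the
  direction of \<open>- \<sigma>\<close>, and lies in the half-plane \<open>3 Re z + 4 Im z > 5 / 2\<close>, which misses the disc
  of radius \<open>1 / 2\<close>.\<close>

fun placed :: "int \<Rightarrow> piece \<Rightarrow> bool" where
  "placed \<sigma> (u, x, y, r, k) \<longleftrightarrow> 0 \<le> r \<and> 50000 + 10 * r < 6 * x + 8 * y \<and>
     (r < \<bar>y - 5510\<bar> \<or> (0 < \<sigma> * (x - 3970) \<and> r\<^sup>2 < (x - 3970)\<^sup>2 + (y - 5510)\<^sup>2))"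

lemma right_arc_placed: "list_all (placed 1) right_arc"
  by code_simp

lemma left_arc_placed: "list_all (placed (-1)) left_arc"
  by code_simp

section \<open>Position of the discs relative to the hole point and the small disc\<close>

lemma disc_square:
  assumes "z \<in> disc x y r"
  shows "(10 ^ 4 * Re z - of_int x)\<^sup>2 + (10 ^ 4 * Im z - of_int y)\<^sup>2 \<le> (of_int r)\<^sup>2"
proof -
  have "norm (z - node x y) \<le> of_int r / 10 ^ 4"
    using assms by (simp add: disc_def dist_norm norm_minus_commute)
  then have "10 ^ 4 * norm (z - node x y) \<le> of_int r" by simp
  then have "(10 ^ 4 * norm (z - node x y))\<^sup>2 \<le> (of_int r)\<^sup>2" by (rule power_mono) simp
  moreover have "(10 ^ 4 * norm (z - node x y))\<^sup>2
      = (10 ^ 4 * (Re z - of_int x / 10 ^ 4))\<^sup>2 + (10 ^ 4 * (Im z - of_int y / 10 ^ 4))\<^sup>2"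
    unfolding power_mult_distrib cmod_power2 by (simp add: node_def)
  moreover have "10 ^ 4 * (a - c / 10 ^ 4) = 10 ^ 4 * a - c" for a c :: real by simp
  ultimately show ?thesis by simp
qed

text \<open>If the horizontal line through \<open>hole_point\<close> meets the disc, the chord is
  centred at the abscissa of the centre. Since \<open>hole_point\<close> is outside the disc, the
  chord stays on the centre's side of it.\<close>

lemma placed_side:
  assumes "placed \<sigma> P" "\<sigma> = 1 \<or> \<sigma> = -1" "z \<in> region P" "Im z = Im hole_point"
  shows "0 < of_int \<sigma> * (Re z - Re hole_point)"
proof -
  obtain u x y r k where P: "P = (u, x, y, r, k)" by (metis prod_cases5)
  let ?a = "10 ^ 4 * Re z"
  have r: "0 \<le> r" using assms(1) by (simp add: P)
  have "z \<in> disc x y r" using assms(3) by (simp add: P region_def zeros_def)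
  from disc_square[OF this] have d: "(?a - of_int x)\<^sup>2 + (of_int (y - 5510))\<^sup>2 \<le> (of_int r)\<^sup>2"
    using assms(4) by (simp add: hole_point_def node_def power2_commute)
  have "\<not> r < \<bar>y - 5510\<bar>"
  proof
    assume "r < \<bar>y - 5510\<bar>"
    then have "real_of_int r < \<bar>of_int (y - 5510)\<bar>" by linarith
    then have "(real_of_int r)\<^sup>2 < \<bar>of_int (y - 5510)\<bar>\<^sup>2" by (rule power_strict_mono) (use r in auto)
    then have "(real_of_int r)\<^sup>2 < (of_int (y - 5510))\<^sup>2" by simp
    then show False using d zero_le_power2[of "?a - of_int x"] by linarith
  qed
  then have s: "0 < \<sigma> * (x - 3970)" "r\<^sup>2 < (x - 3970)\<^sup>2 + (y - 5510)\<^sup>2"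
    using assms(1) by (auto simp: P)
  have "(of_int r)\<^sup>2 < (of_int (x - 3970))\<^sup>2 + (of_int (y - 5510) :: real)\<^sup>2"
    using s(2) by (metis of_int_add of_int_less_iff of_int_power)
  with d have "(?a - of_int x)\<^sup>2 < (of_int (x - 3970))\<^sup>2" by linarith
  then have "\<bar>?a - of_int x\<bar>\<^sup>2 < \<bar>of_int (x - 3970)\<bar>\<^sup>2" by simp
  then have "\<bar>?a - of_int x\<bar> < \<bar>of_int (x - 3970)\<bar>" by (rule power_less_imp_less_base) simp
  then show ?thesis
    using s(1) assms(2) by (auto simp: hole_point_def node_def)
qed

text \<open>Multiplication by the unit vector (3 - 4 i) / 5 turns the half-plane into Re > 1/2,
  while it keeps |w| < 1/2. This is the hypothesis \<open>half\<close> of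
  \<open>arcs_separate\<close>.\<close>

lemma placed_half_plane:
  assumes "placed \<sigma> P" "z \<in> region P" "norm w < 1 / 2"
  shows "0 < Re ((z - w) * Complex (3 / 5) (- 4 / 5))"
proof -
  obtain u x y r k where P: "P = (u, x, y, r, k)" by (metis prod_cases5)
  define d where "d = Complex (3 / 5) (- 4 / 5)"
  have nd: "norm d = 1" by (simp add: d_def cmod_def power_divide)
  have i: "50000 + 10 * r < 6 * x + 8 * y" using assms(1) by (simp add: P)
  have "z \<in> disc x y r" using assms(2) by (simp add: P region_def zeros_def)
  then have "norm ((z - node x y) * d) \<le> of_int r / 10 ^ 4"
    by (simp add: norm_mult nd disc_def dist_norm norm_minus_commute)
  then have 1: "- (of_int r / 10 ^ 4) \<le> Re ((z - node x y) * d)"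
    using abs_Re_le_cmod[of "(z - node x y) * d"] by linarith
  have "norm (w * d) < 1 / 2" using assms(3) by (simp add: norm_mult nd)
  then have 2: "Re (w * d) < 1 / 2" using complex_Re_le_cmod[of "w * d"] by linarith
  have "real_of_int (50000 + 10 * r) < of_int (6 * x + 8 * y)" using i by (simp only: of_int_less_iff)
  then have 3: "1 / 2 + of_int r / 10 ^ 4 < Re (node x y * d)" by (simp add: node_def d_def)
  have "(z - w) * d = (z - node x y) * d + node x y * d - w * d" by (simp add: algebra_simps)
  then have "Re ((z - w) * d) = Re ((z - node x y) * d) + Re (node x y * d) - Re (w * d)"
    by (simp only: minus_complex.sel plus_complex.sel)
  then show ?thesis unfolding d_def[symmetric] using 1 2 3 by linarith
qed

section \<open>The hole\<close>

text \<open>\<open>x + i y\<close> and \<open>p + i q\<close> are a partial sum at \<open>hole_point\<close> and the next power, up to a common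
  factor; the search stops once no tail can cancel the partial sum.\<close>

fun escapes :: "nat \<Rightarrow> int \<Rightarrow> int \<Rightarrow> int \<Rightarrow> int \<Rightarrow> bool" where
  "escapes 0 x y p q \<longleftrightarrow> 10 * (p\<^sup>2 + q\<^sup>2) < x\<^sup>2 + y\<^sup>2"
| "escapes (Suc n) x y p q \<longleftrightarrow> 10 * (p\<^sup>2 + q\<^sup>2) < x\<^sup>2 + y\<^sup>2 \<or>
    escapes n (1000 * (x + p)) (1000 * (y + q)) (397 * p - 551 * q) (397 * q + 551 * p) \<and>
    escapes n (1000 * (x - p)) (1000 * (y - q)) (397 * p - 551 * q) (397 * q + 551 * p)"

lemma norm_hole_point: "norm hole_point \<le> 849 / 1250"
  using norm_node_le[of 3970 5510 6792] by (simp add: hole_point_def)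

text \<open>A tail is at most 1 / (1 - 849/1250) = 1250/401 times the next power, and 10 is the
  square of this factor rounded up.\<close>

lemma large_partial_sum:
  fixes x y p q :: int
  assumes f: "10 * (p\<^sup>2 + q\<^sup>2) < x\<^sup>2 + y\<^sup>2" and e: "e \<in> signs"
  shows "Complex (of_int x) (of_int y) + Complex (of_int p) (of_int q) * series e hole_point \<noteq> 0"
proof
  let ?X = "Complex (of_int x) (of_int y)" and ?W = "Complex (of_int p) (of_int q)"
  assume "?X + ?W * series e hole_point = 0"
  then have "?X = - (?W * series e hole_point)" by (simp add: eq_neg_iff_add_eq_0)
  then have "norm ?X = norm ?W * norm (series e hole_point)" by (simp add: norm_mult)
  also have "\<dots> \<le> norm ?W * (1250 / 401)"
    using norm_series_le[OF e norm_hole_point] by (intro mult_left_mono) auto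
  finally have "(norm ?X)\<^sup>2 \<le> (norm ?W * (1250 / 401))\<^sup>2" by (rule power_mono) simp
  also have "\<dots> \<le> 10 * (norm ?W)\<^sup>2" by (simp add: power_mult_distrib power_divide)
  finally have "real_of_int (x\<^sup>2 + y\<^sup>2) \<le> of_int (10 * (p\<^sup>2 + q\<^sup>2))" by (simp add: cmod_power2)
  then show False using f by (simp only: of_int_le_iff)
qed

lemma escapes_sound:
  "escapes n x y p q \<Longrightarrow> e \<in> signs \<Longrightarrow>
    Complex (of_int x) (of_int y) + Complex (of_int p) (of_int q) * series e hole_point \<noteq> 0"
proof (induction n arbitrary: x y p q e)
  case 0
  then show ?case using large_partial_sum by simp
next
  case (Suc n)
  show ?case
  proof (cases "10 * (p\<^sup>2 + q\<^sup>2) < x\<^sup>2 + y\<^sup>2")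
    case True
    then show ?thesis using large_partial_sum Suc.prems(2) by blast
  next
    case False
    let ?X = "Complex (of_int x) (of_int y)" and ?W = "Complex (of_int p) (of_int q)"
    let ?e = "\<lambda>k. e (Suc k)"
    have "1000 * hole_point = Complex 397 551" by (simp add: hole_point_def node_def complex_eq_iff)
    then have W: "Complex (of_int (397 * p - 551 * q)) (of_int (397 * q + 551 * p)) = ?W * (1000 * hole_point)"
      by (simp add: complex_eq_iff)
    have e': "?e \<in> signs" using Suc.prems(2) by (rule signs_Suc)
    have h: "series e hole_point = of_int (e 0) + hole_point * series ?e hole_point"
      using Suc.prems(2) norm_hole_point by (intro series_head) auto
    have step: "escapes n (1000 * (x + e 0 * p)) (1000 * (y + e 0 * q)) (397 * p - 551 * q) (397 * q + 551 * p)"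
      using Suc.prems(1) False signs_values[OF Suc.prems(2), of 0] by auto
    have "Complex (of_int (1000 * (x + e 0 * p))) (of_int (1000 * (y + e 0 * q)))
        = 1000 * (?X + of_int (e 0) * ?W)" by (simp add: complex_eq_iff)
    then have "1000 * (?X + of_int (e 0) * ?W) + ?W * (1000 * hole_point) * series ?e hole_point \<noteq> 0"
      using Suc.IH[OF step e'] W by simp
    then have "1000 * (?X + ?W * series e hole_point) \<noteq> 0" by (simp add: h algebra_simps)
    then show ?thesis by (metis mult_zero_right)
  qed
qed

lemma hole_point_notin_M0: "hole_point \<notin> M0"
proof -
  \<comment> \<open>The search starts with the empty sum 0 and the power 1; sixteen coefficients
    decide every branch.\<close>
  have "escapes 16 0 0 1 0" by code_simp
  then have "series e hole_point \<noteq> 0" if "e \<in> signs" for e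
    using escapes_sound[OF _ that] by (fastforce simp: complex_eq_iff)
  then show ?thesis by (auto simp: M0_iff)
qed

lemma left_arc_properties:
  "closed (support left_arc)" "connected (support left_arc)" "support left_arc \<subseteq> M0"
proof -
  let ?P = "hd left_arc" and ?Q = "hd (tl left_arc)"
  have U: "support left_arc = region ?P \<union> support (tl left_arc)" "?Q \<in> set (tl left_arc)"
    by (auto simp: support_def left_arc_def)
  then have "region ?P \<inter> support (tl left_arc) \<noteq> {}"
    using left_arc_closing by (auto simp: support_def)
  then show "closed (support left_arc)" "connected (support left_arc)" "support left_arc \<subseteq> M0"
    unfolding U(1)
    using valid_piece_properties[OF left_arc_start_valid] linked_properties[OF left_arc_linked]
    by (auto intro: connected_Un)
qed

theorem theorem11p3p1:
  shows "\<exists>z \<in> punctured_disc - M0.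
           connected_component_set (punctured_disc - M0) z
             \<inter> {w. 0 < cmod w \<and> cmod w < 1/2} = {}"
proof
  have "norm hole_point < 1" using norm_hole_point by simp
  moreover have "hole_point \<noteq> 0" by (simp add: hole_point_def node_def complex_eq_iff)
  ultimately show hole: "hole_point \<in> punctured_disc - M0"
    using hole_point_notin_M0 by (simp add: punctured_disc_def)
  let ?C = "connected_component_set (punctured_disc - M0) hole_point"
  have right: "closed (support right_arc)" "connected (support right_arc)" "support right_arc \<subseteq> M0"
    using linked_properties[OF right_arc_linked] by auto
  have sides: "\<exists>P. P \<in> set right_arc \<and> placed 1 P \<and> x \<in> region P" if "x \<in> support right_arc" for x
    using that right_arc_placed unfolding support_def list_all_iff by blast
  have sides': "\<exists>P. P \<in> set left_arc \<and> placed (-1) P \<and> x \<in> region P" if "x \<in> support left_arc" for x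
    using that left_arc_placed unfolding support_def list_all_iff by blast
  have ends: "last right_arc \<in> set right_arc" "hd right_arc \<in> set right_arc"
      "last left_arc \<in> set left_arc" "hd left_arc \<in> set left_arc"
    by (simp_all add: right_arc_def left_arc_def)
  \<comment> \<open>The contacts of the two arcs are known to within 2 / 10^4, enough to see that
    one lies above and the other below the height 0.551 of \<open>hole_point\<close>.\<close>
  obtain p where p: "p \<in> support right_arc \<inter> support left_arc" "p \<in> disc 3956 5575 2"
    using link_meets[OF arcs_linked(1)] ends by (auto simp: support_def)
  obtain q where q: "q \<in> support right_arc \<inter> support left_arc" "q \<in> disc 3955 5470 2"
    using link_meets[OF arcs_linked(2)] ends by (auto simp: support_def)
  have Im_disc: "\<bar>Im z - of_int y / 10 ^ 4\<bar> \<le> of_int r / 10 ^ 4" if "z \<in> disc x y r" for z x y r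
    using that abs_Im_le_cmod[of "z - node x y"]
    by (simp add: disc_def dist_norm norm_minus_commute node_def)
  show "?C \<inter> {w. 0 < cmod w \<and> cmod w < 1/2} = {}"
  proof (rule ccontr)
    assume "?C \<inter> {w. 0 < cmod w \<and> cmod w < 1/2} \<noteq> {}"
    then obtain w where w: "w \<in> ?C" "cmod w < 1 / 2" by blast
    show False
    proof (rule arcs_separate[of "support right_arc" hole_point "support left_arc" p q w "Complex (3 / 5) (- 4 / 5)" ?C])
      show "Re hole_point < Re x" if x: "x \<in> support right_arc" "Im x = Im hole_point" for x
      proof -
        obtain P where P: "placed 1 P" "x \<in> region P" using sides[OF x(1)] by blast
        show ?thesis using placed_side[OF P(1) _ P(2) x(2)] by simp
      qed
      show "Re x < Re hole_point" if x: "x \<in> support left_arc" "Im x = Im hole_point" for x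
      proof -
        obtain P where P: "placed (-1) P" "x \<in> region P" using sides'[OF x(1)] by blast
        show ?thesis using placed_side[OF P(1) _ P(2) x(2)] by simp
      qed
      show "Im hole_point < Im p" using Im_disc[OF p(2)] by (simp add: hole_point_def node_def abs_if split: if_splits)
      show "Im q < Im hole_point" using Im_disc[OF q(2)] by (simp add: hole_point_def node_def abs_if split: if_splits)
      show "0 < Re ((x - w) * Complex (3 / 5) (- 4 / 5))" if "x \<in> support right_arc \<union> support left_arc" for x
        using that sides[of x] sides'[of x] placed_half_plane[OF _ _ w(2), of _ _ x] by blast
      show "?C \<inter> (support right_arc \<union> support left_arc) = {}"
        using right(3) left_arc_properties(3) connected_component_subset[of "punctured_disc - M0" hole_point] by blast
      show "hole_point \<in> ?C" using hole by simp
    qed (use right left_arc_properties p q w in auto)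
  qed
qed

end
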